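(* Let $\mathbb{F}$ be a field and let $n,k$ be integers with $k \ge 3$, $n \ge k+2$, $|\mathbb{F}| > k$ and $n+k$ even. If $\phi, \psi \colon M_{n\,k}(\mathbb{F}) \to M_{n\,k}(\mathbb{F})$ are two maps satisfying $$\det\nolimits_{n\,k}(X + \lambda Y) = \det\nolimits_{n\,k}(\phi(X) + \lambda \psi(Y))\quad\text{for all } X, Y \in M_{n\,k}(\mathbb{F}),\ \lambda \in \mathbb{F},$$ then there exist $A \in M_{n\,n}(\mathbb{F})$ and $B \in M_{k\,k}(\mathbb{F})$ such that $$\det\nolimits_{n\,k}\bigl(A(|i_1,\ldots,i_k]\bigr)\cdot \det(B) = (-1)^{i_1+\ldots+i_k-1-\ldots-k}$$ for all increasing sequences $1 \le i_1 < \ldots < i_k \le n$, and $$\phi(X) = \psi(X) = AXB\quad\text{for all } X \in M_{n\,k}(\mathbb{F}).$$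
   Context: $M_{n\,k}(\mathbb{F})$ denotes the space of $n\times k$ matrices over $\mathbb{F}$. For $n\ge k$, the Cullis' determinant $\det_{n\,k}\colon M_{n\,k}(\mathbb{F})\to\mathbb{F}$ is $$\det\nolimits_{n\,k}(X) = \sum_{1\le i_1<\ldots<i_k\le n} (-1)^{i_1+\ldots+i_k-1-\ldots-k}\det\bigl(X_{i_1,\ldots,i_k}\bigr),$$ where $X_{i_1,\ldots,i_k}$ is the $k\times k$ submatrix of $X$ formed by rows $i_1,\ldots,i_k$ and all columns, and $\det$ is the ordinary determinant. For $A\in M_{n\,n}(\mathbb{F})$, $A(|i_1,\ldots,i_k]$ denotes the $n\times k$ submatrix of $A$ formed by all rows and by columns $i_1,\ldots,i_k$. The maps $\phi,\psi$ are not assumed linear or surjective. *)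

theory Defs
  imports
    "Jordan_Normal_Form.Determinant"
    "Jordan_Normal_Form.DL_Submatrix"
begin

text \<open>
  An increasing sequence \<open>1 \<le> i\<^sub>1 < \<dots> < i\<^sub>k \<le> n\<close> is represented by the set of its shifted
  values \<open>{i\<^sub>1 - 1, \<dots>, i\<^sub>k - 1}\<close>, because matrix indices start at 0. The library's
  submatrix operation enumerates such an index set in increasing order.
\<close>

definition index_sets :: "nat \<Rightarrow> nat \<Rightarrow> nat set set" where
  "index_sets n k = {I. I \<subseteq> {0..<n} \<and> card I = k}"

text \<open>
  Both \<open>i\<^sub>1 + \<dots> + i\<^sub>k\<close> and \<open>1 + \<dots> + k\<close> drop by \<open>k\<close> under the shift, so the exponent below is
  \<open>i\<^sub>1 + \<dots> + i\<^sub>k - 1 - \<dots> - k\<close>. The subtraction never truncates for a finite \<open>I\<close> with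
  \<open>card I = k\<close>, as \<open>0 + \<dots> + (k - 1)\<close> is the least sum of \<open>k\<close> distinct naturals.
\<close>

definition cullis_sign :: "nat \<Rightarrow> nat set \<Rightarrow> 'a :: comm_ring_1" where
  "cullis_sign k I = (- 1) ^ (\<Sum>I - \<Sum>{0..<k})"

definition cullis_det :: "nat \<Rightarrow> nat \<Rightarrow> 'a :: comm_ring_1 mat \<Rightarrow> 'a" where
  "cullis_det n k X =
     (\<Sum>I\<in>index_sets n k. cullis_sign k I * det (submatrix X I UNIV))"

end

theory Submission
  imports Defs
begin

text \<open>
  Regard the Cullis determinant as an alternating \<open>k\<close>-form on columns. Comparing coefficients of the
  scalar, which is possible because the field has more than \<open>k\<close> elements, shows that the pair
  \<open>(\<phi>, \<psi>)\<close> preserves every polarisation of the form. As \<open>n + k\<close> is even, the form is nondegenerate,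
  so preservation of the first polarisation alone makes \<open>\<phi>\<close> and \<open>\<psi>\<close> linear and bijective, and
  then equal.

  Let \<open>\<tau>\<close> be the alternating sum of the first \<open>n - k + 3\<close> entries of a column. If contracting the
  form with columns \<open>x\<close> and \<open>y\<close> gives 0, then \<open>\<tau> x \<cdot> y = \<tau> y \<cdot> x\<close>: for \<open>k = 3\<close> the form
  is the product of \<open>\<tau>\<close> with a 2-form whose kernel is a line complementary to the kernel of \<open>\<tau>\<close>,
  and larger \<open>k\<close> follow by deleting the last row and column. The matrices with vanishing second
  polarisation contain all those of rank 1, and among matrices with some nonzero \<open>\<tau>\<close> there are no
  others. Hence the linear map sends most spaces \<open>F\<^sup>n \<otimes> u\<close> to spaces \<open>F\<^sup>n \<otimes> s\<close>, as \<open>n > k\<close>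
  excludes images \<open>z \<otimes> F\<^sup>k\<close>, and comparing different \<open>u\<close> yields the form \<open>A X B\<close>.
\<close>

subsection \<open>The Cullis determinant as an alternating form\<close>

text \<open>The column index comes first in \<open>f j i\<close>, so replacing a column is the
  function update \<open>f(j := u)\<close>; values outside the \<open>n\<close> by \<open>k\<close>
  range are ignored.\<close>

definition cullis_form :: "nat \<Rightarrow> nat \<Rightarrow> (nat \<Rightarrow> nat \<Rightarrow> 'a :: comm_ring_1) \<Rightarrow> 'a" where
  "cullis_form n k f = cullis_det n k (mat n k (\<lambda>(i, j). f j i))"

lemma finite_index_sets [simp]: "finite (index_sets n k)"
  unfolding index_sets_def by (rule finite_subset[of _ "Pow {0..<n}"]) auto

lemma pick_less_index_set:
  assumes "I \<in> index_sets n k" and "i < k"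
  shows "pick I i < n"
  using assms pick_in_set_le[of i I] unfolding index_sets_def by auto

lemma submatrix_rows:
  assumes "I \<in> index_sets n k" and "X \<in> carrier_mat n m"
  shows "submatrix X I UNIV = mat k m (\<lambda>(i, j). X $$ (pick I i, j))"
proof -
  have "{i. i < n \<and> i \<in> I} = I"
    using assms(1) unfolding index_sets_def by auto
  then show ?thesis
    using assms unfolding submatrix_def index_sets_def by (auto simp: pick_UNIV)
qed

lemma cullis_form_altdef:
  "cullis_form n k f = (\<Sum>I\<in>index_sets n k. cullis_sign k I * det (mat k k (\<lambda>(i, j). f j (pick I i))))"
proof -
  have "submatrix (mat n k (\<lambda>(i, j). f j i)) I UNIV = mat k k (\<lambda>(i, j). f j (pick I i))"
    if "I \<in> index_sets n k" for I
    by (subst submatrix_rows[OF that]) (auto simp: pick_less_index_set[OF that])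
  then show ?thesis
    unfolding cullis_form_def cullis_det_def by simp
qed

text \<open>Permuting the rows keeps exactly one factor per column in each summand, so
  multilinearity and polarisation reduce to expanding products.\<close>

lemma cullis_form_leibniz:
  "cullis_form n k f = (\<Sum>I\<in>index_sets n k. \<Sum>p | p permutes {0..<k}.
      cullis_sign k I * signof p * (\<Prod>j<k. f j (pick I (p j))))"
  unfolding cullis_form_altdef
proof (intro sum.cong refl)
  fix I assume "I \<in> index_sets n k"
  have *: "p j < k" if "p permutes {0..<k}" "j < k" for p j
    using permutes_in_image[OF that(1), of j] that(2) by simp
  have "det (mat k k (\<lambda>(i, j). f j (pick I i))) =
      (\<Sum>p | p permutes {0..<k}. signof p * (\<Prod>j<k. f j (pick I (p j))))"
    by (subst det_col[of _ k]) (auto intro!: sum.cong prod.cong simp: *)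
  then show "cullis_sign k I * det (mat k k (\<lambda>(i, j). f j (pick I i))) =
      (\<Sum>p | p permutes {0..<k}. cullis_sign k I * signof p * (\<Prod>j<k. f j (pick I (p j))))"
    by (simp add: sum_distrib_left mult.assoc)
qed

lemma cullis_form_cong:
  assumes "\<And>i j. i < n \<Longrightarrow> j < k \<Longrightarrow> f j i = g j i"
  shows "cullis_form n k f = cullis_form n k g"
  unfolding cullis_form_def by (rule arg_cong[where f = "cullis_det n k"]) (auto intro!: eq_matI assms)

lemma cullis_form_linear_combination:
  assumes "j < k"
  shows "cullis_form n k (f(j := \<lambda>i. a * u i + b * v i)) =
    a * cullis_form n k (f(j := u)) + b * cullis_form n k (f(j := v))"
proof -
  have *: "(\<Prod>l<k. (f(j := w)) l (q l)) = w (q j) * (\<Prod>l\<in>{..<k} - {j}. f l (q l))" for w q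
    using assms by (subst prod.remove[of _ j]) (auto intro!: prod.cong)
  show ?thesis
    unfolding cullis_form_leibniz * by (simp add: sum_distrib_left sum.distrib algebra_simps)
qed

lemma cullis_form_sum:
  assumes "j < k" and "finite S"
  shows "cullis_form n k (f(j := \<lambda>i. \<Sum>s\<in>S. c s * u s i)) = (\<Sum>s\<in>S. c s * cullis_form n k (f(j := u s)))"
  using assms(2)
proof (induction S)
  case empty
  show ?case
    using cullis_form_linear_combination[OF assms(1), of n f 0 "\<lambda>_. 0" 0 "\<lambda>_. 0"]
    by (simp only: mult_zero_left add_0_left sum.empty)
next
  case (insert x S)
  then show ?case
    using cullis_form_linear_combination[OF assms(1), of n f "c x" "u x" 1 "\<lambda>i. \<Sum>s\<in>S. c s * u s i"]
    by (simp only: sum.insert[OF insert.hyps] mult_1_left)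
qed

lemma cullis_form_zero_column:
  assumes "j < k" and "\<And>i. i < n \<Longrightarrow> f j i = 0"
  shows "cullis_form n k f = 0"
proof -
  have "cullis_form n k f = cullis_form n k (f(j := \<lambda>_. 0))"
    by (rule cullis_form_cong) (auto simp: assms)
  also have "\<dots> = 0"
    using cullis_form_sum[OF assms(1), of "{}"] by simp
  finally show ?thesis .
qed

lemma cullis_form_equal_columns:
  assumes "j < k" "l < k" "j \<noteq> l" and "\<And>i. i < n \<Longrightarrow> f j i = f l i"
  shows "cullis_form n k f = 0"
  unfolding cullis_form_altdef
proof (intro sum.neutral ballI)
  fix I assume I: "I \<in> index_sets n k"
  have "det (mat k k (\<lambda>(i, j). f j (pick I i))) = 0"
    by (rule det_identical_columns[of _ k j l])
      (use assms pick_less_index_set[OF I] in \<open>auto simp: col_def\<close>)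
  then show "cullis_sign k I * det (mat k k (\<lambda>(i, j). f j (pick I i))) = 0"
    by simp
qed

text \<open>The form vanishes on equal columns, so placing \<open>u + v\<close> in both positions
  and expanding leaves two mixed terms with sum 0.\<close>

lemma cullis_form_swap_columns:
  assumes "j < k" "l < k" "j \<noteq> l"
  shows "cullis_form n k (f(j := u, l := v)) = - cullis_form n k (f(j := v, l := u))"
proof -
  let ?w = "\<lambda>i. 1 * u i + 1 * v i"
  have sp: "cullis_form n k (f(j := \<lambda>i. 1 * u i + 1 * v i, l := w)) =
      cullis_form n k (f(j := u, l := w)) + cullis_form n k (f(j := v, l := w))" for w
    using cullis_form_linear_combination[of j k n "f(l := w)" 1 u 1 v] assms by (simp add: fun_upd_twist)
  have "0 = cullis_form n k (f(j := ?w, l := ?w))"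
    using assms by (subst cullis_form_equal_columns[of j k l]) auto
  also have "\<dots> = cullis_form n k (f(j := ?w, l := u)) + cullis_form n k (f(j := ?w, l := v))"
    using cullis_form_linear_combination[of l k n "f(j := ?w)" 1 u 1 v] assms by simp
  also have "\<dots> = cullis_form n k (f(j := u, l := v)) + cullis_form n k (f(j := v, l := u))"
    unfolding sp using assms
    by (simp add: cullis_form_equal_columns[of j k l n "f(j := u, l := u)"]
        cullis_form_equal_columns[of j k l n "f(j := v, l := v)"])
  finally show ?thesis
    by (simp add: eq_neg_iff_add_eq_0)
qed

section \<open>Deleting the last row and column\<close>

lemma cullis_form_zero_last_row:
  assumes "\<And>j. j < k \<Longrightarrow> f j n = 0"
  shows "cullis_form (Suc n) k f = cullis_form n k f"
  unfolding cullis_form_altdef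
proof (rule sum.mono_neutral_right)
  show "index_sets n k \<subseteq> index_sets (Suc n) k"
    unfolding index_sets_def by auto
  show "\<forall>I\<in>index_sets (Suc n) k - index_sets n k.
      cullis_sign k I * det (mat k k (\<lambda>(i, j). f j (pick I i))) = 0"
  proof
    fix I assume I: "I \<in> index_sets (Suc n) k - index_sets n k"
    then have "n \<in> I" and c: "card I = k"
      unfolding index_sets_def by (auto simp: less_Suc_eq atLeast0_lessThan_Suc)
    \<comment> \<open>The position of row \<open>n\<close> in \<open>I\<close>: row \<open>r\<close>
      of the minor is zero, so every Leibniz term has a zero factor.\<close>
    define r where "r = card {a \<in> I. a < n}"
    have r: "pick I r = n" "r < k"
      using pick_card_in_set[OF \<open>n \<in> I\<close>] c \<open>n \<in> I\<close> I unfolding r_def index_sets_def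
      by (auto intro!: psubset_card_mono intro: finite_subset)
    have "det (mat k k (\<lambda>(i, j). f j (pick I i))) = 0"
    proof -
      have "det (mat k k (\<lambda>(i, j). f j (pick I i))) =
          (\<Sum>p | p permutes {0..<k}. signof p * (\<Prod>i = 0..<k. mat k k (\<lambda>(i, j). f j (pick I i)) $$ (i, p i)))"
        by (rule det_def') auto
      also have "\<dots> = 0"
      proof (intro sum.neutral ballI)
        fix p assume "p \<in> {p. p permutes {0..<k}}"
        then have "p r < k"
          using r permutes_in_image[of p "{0..<k}" r] by simp
        then have "mat k k (\<lambda>(i, j). f j (pick I i)) $$ (r, p r) = 0"
          using r assms by simp
        then have "(\<Prod>i = 0..<k. mat k k (\<lambda>(i, j). f j (pick I i)) $$ (i, p i)) = 0"
          using r(2) by (intro prod_zero) (auto intro!: bexI[of _ r])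
        then show "signof p * (\<Prod>i = 0..<k. mat k k (\<lambda>(i, j). f j (pick I i)) $$ (i, p i)) = 0"
          by simp
      qed
      finally show ?thesis .
    qed
    then show "cullis_sign k I * det (mat k k (\<lambda>(i, j). f j (pick I i))) = 0"
      by simp
  qed
qed auto

text \<open>Turning the subtraction into an addition keeps the parity, because
  \<open>\<Sum>I\<close> is at least \<open>0 + ... + (k - 1)\<close>. The additive exponent is easy
  to follow when \<open>I\<close> is enlarged.\<close>

lemma cullis_sign_altdef:
  assumes "I \<in> index_sets n k"
  shows "cullis_sign k I = (- 1 :: 'a :: comm_ring_1) ^ (\<Sum>I + \<Sum>{0..<k})"
proof -
  have le: "\<Sum>{0..<card A} \<le> \<Sum>A" if "finite A" for A :: "nat set"
    using that
  proof (induction A rule: finite_linorder_max_induct)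
    case (insert b A)
    then have "card A \<le> card {..<b}"
      by (intro card_mono) auto
    with insert show ?case
      by (subst sum.insert) (auto simp: card_insert_if)
  qed simp
  have "\<Sum>{0..<k} \<le> \<Sum>I"
    using le[of I] assms finite_subset[of I "{0..<n}"] unfolding index_sets_def by auto
  then have "even (\<Sum>I - \<Sum>{0..<k}) = even (\<Sum>I + \<Sum>{0..<k})"
    by simp
  then show ?thesis
    unfolding cullis_sign_def minus_one_power_iff by simp
qed

lemma det_unit_last_column:
  assumes "\<And>i. i < k \<Longrightarrow> a i k = 0" and "a k k = 1"
  shows "det (mat (Suc k) (Suc k) (\<lambda>(i, j). a i j)) = det (mat k k (\<lambda>(i, j). a i j))"
proof -
  let ?M = "mat (Suc k) (Suc k) (\<lambda>(i, j). a i j)"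
  have "det ?M = (\<Sum>i<Suc k. ?M $$ (i, k) * cofactor ?M i k)"
    by (rule laplace_expansion_column) auto
  also have "\<dots> = cofactor ?M k k"
    using assms by simp
  also have "\<dots> = det (mat k k (\<lambda>(i, j). a i j))"
  proof -
    have "mat_delete ?M k k = mat k k (\<lambda>(i, j). a i j)"
      unfolding mat_delete_def by (rule eq_matI) auto
    moreover have "(-1 :: 'a) ^ (k + k) = 1"
      by (simp add: minus_one_power_iff)
    ultimately show ?thesis
      unfolding cofactor_def by simp
  qed
  finally show ?thesis .
qed

text \<open>Only index sets containing row \<open>n\<close> survive, and they arise by adding
  \<open>n\<close> to the sets of size \<open>k\<close> below \<open>n\<close>. This raises the
  additive exponent by \<open>n + k\<close>.\<close>

lemma cullis_form_unit_last_column: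
  "cullis_form (Suc n) (Suc k) (f(k := \<lambda>i. if i = n then 1 else 0)) = (- 1) ^ (n + k) * cullis_form n k f"
proof -
  let ?g = "f(k := \<lambda>i. if i = n then 1 else 0)"
  let ?t = "\<lambda>I. cullis_sign (Suc k) I * det (mat (Suc k) (Suc k) (\<lambda>(i, j). ?g j (pick I i)))"
  have fin: "finite I \<and> card I = k \<and> n \<notin> I" if "I \<in> index_sets n k" for I
    using that unfolding index_sets_def by (auto intro: finite_subset)
  have ins: "insert n I \<in> index_sets (Suc n) (Suc k)" if "I \<in> index_sets n k" for I
    using fin[OF that] that unfolding index_sets_def by (auto simp: less_Suc_eq)
  have inj: "inj_on (insert n) (index_sets n k)"
    using fin by (intro inj_onI) (simp add: insert_ident)
  have "cullis_form (Suc n) (Suc k) ?g = sum ?t (index_sets (Suc n) (Suc k))"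
    by (rule cullis_form_altdef)
  also have "\<dots> = sum ?t (insert n ` index_sets n k)"
  proof (rule sum.mono_neutral_right)
    show "insert n ` index_sets n k \<subseteq> index_sets (Suc n) (Suc k)"
      using ins by (rule image_subsetI)
    show "\<forall>I\<in>index_sets (Suc n) (Suc k) - insert n ` index_sets n k. ?t I = 0"
    proof
      fix I assume "I \<in> index_sets (Suc n) (Suc k) - insert n ` index_sets n k"
      then have I: "I \<in> index_sets (Suc n) (Suc k)" and nI: "I \<notin> insert n ` index_sets n k"
        by simp_all
      have "n \<notin> I"
      proof
        assume "n \<in> I"
        with I have "I - {n} \<in> index_sets n k"
          unfolding index_sets_def by (auto simp: less_Suc_eq)
        moreover have "I = insert n (I - {n})"
          using \<open>n \<in> I\<close> by auto
        ultimately have "I \<in> insert n ` index_sets n k"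
          by (intro image_eqI)
        with nI show False
          by simp
      qed
      then have "pick I i \<noteq> n" if "i < Suc k" for i
        using that I pick_in_set_le[of i I] unfolding index_sets_def by auto
      then have "det (mat (Suc k) (Suc k) (\<lambda>(i, j). ?g j (pick I i))) = 0"
        by (subst laplace_expansion_column[of _ "Suc k" k]) auto
      then show "?t I = 0"
        by simp
    qed
  qed simp
  also have "\<dots> = (\<Sum>I\<in>index_sets n k. ?t (insert n I))"
    by (rule sum.reindex_cong[OF inj]) auto
  also have "\<dots> = (\<Sum>I\<in>index_sets n k.
      (- 1) ^ (n + k) * (cullis_sign k I * det (mat k k (\<lambda>(i, j). f j (pick I i)))))"
  proof (rule sum.cong[OF refl])
    fix I assume I: "I \<in> index_sets n k"
    note II = ins[OF I]
    have red: "{a. a < n \<and> a \<in> insert n I} = I"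
      using I unfolding index_sets_def by auto
    have pick_lt: "pick (insert n I) i = pick I i" if "i < k" for i
      using pick_reduce_set[of i n "insert n I"] fin[OF I] that unfolding red by simp
    have pick_k: "pick (insert n I) k = n"
    proof -
      have "{a \<in> insert n I. a < n} = I"
        using red by blast
      then show ?thesis
        using pick_card_in_set[of n "insert n I"] fin[OF I] by simp
    qed
    have "det (mat (Suc k) (Suc k) (\<lambda>(i, j). ?g j (pick (insert n I) i))) =
        det (mat k k (\<lambda>(i, j). ?g j (pick (insert n I) i)))"
      using pick_lt pick_less_index_set[OF I] pick_k
      by (intro det_unit_last_column) (force simp: nat_neq_iff)+
    also have "mat k k (\<lambda>(i, j). ?g j (pick (insert n I) i)) = mat k k (\<lambda>(i, j). f j (pick I i))"
      by (rule eq_matI) (auto simp: pick_lt)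
    finally have d: "det (mat (Suc k) (Suc k) (\<lambda>(i, j). ?g j (pick (insert n I) i))) =
        det (mat k k (\<lambda>(i, j). f j (pick I i)))" .
    have s: "cullis_sign (Suc k) (insert n I) = (- 1 :: 'a) ^ (n + k) * cullis_sign k I"
      unfolding cullis_sign_altdef[OF I] cullis_sign_altdef[OF II]
      using fin[OF I] by (simp add: power_add mult_ac)
    show "?t (insert n I) =
        (- 1) ^ (n + k) * (cullis_sign k I * det (mat k k (\<lambda>(i, j). f j (pick I i))))"
      unfolding d s by (simp add: mult.assoc)
  qed
  also have "\<dots> = (- 1) ^ (n + k) * cullis_form n k f"
    by (simp add: cullis_form_altdef sum_distrib_left)
  finally show ?thesis .
qed

subsection \<open>Contractions and nondegeneracy\<close>

abbreviation unit_col :: "nat \<Rightarrow> nat \<Rightarrow> 'a :: comm_ring_1" where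
  "unit_col n \<equiv> \<lambda>i. if i = n then 1 else 0"

text \<open>The form with a single column; on \<open>m = n - k + 3\<close> rows it is the functional
  \<tau> of the overview.\<close>

definition alt_sum :: "nat \<Rightarrow> (nat \<Rightarrow> 'a :: comm_ring_1) \<Rightarrow> 'a" where
  "alt_sum n x = (\<Sum>i<n. (- 1) ^ i * x i)"

definition wedge2 :: "nat \<Rightarrow> (nat \<Rightarrow> 'a :: comm_ring_1) \<Rightarrow> (nat \<Rightarrow> 'a) \<Rightarrow> 'a" where
  "wedge2 n x y = cullis_form n 2 ((\<lambda>_ _. 0)(0 := x, 1 := y))"

definition wedge3 :: "nat \<Rightarrow> (nat \<Rightarrow> 'a :: comm_ring_1) \<Rightarrow> (nat \<Rightarrow> 'a) \<Rightarrow> (nat \<Rightarrow> 'a) \<Rightarrow> 'a" where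
  "wedge3 n x y z = cullis_form n 3 ((\<lambda>_ _. 0)(0 := x, 1 := y, 2 := z))"

lemma alt_sum_Suc: "alt_sum (Suc n) x = alt_sum n x + (- 1) ^ n * x n"
  by (simp add: alt_sum_def)

lemma alt_sum_0 [simp]: "alt_sum 0 x = 0"
  by (simp add: alt_sum_def)

lemma alt_sum_linear_combination:
  "alt_sum n (\<lambda>i. a * x i + b * y i) = a * alt_sum n x + b * alt_sum n y"
  by (simp add: alt_sum_def sum_distrib_left sum.distrib algebra_simps)

lemma alt_sum_cong: "(\<And>i. i < n \<Longrightarrow> x i = y i) \<Longrightarrow> alt_sum n x = alt_sum n y"
  by (simp add: alt_sum_def)

lemma alt_sum_unit_col: "alt_sum n (unit_col i) = (if i < n then (- 1) ^ i else 0)"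
  by (induction n) (auto simp: alt_sum_Suc less_Suc_eq)

lemma alt_sum_one: "alt_sum n (\<lambda>_. 1 :: 'a :: comm_ring_1) = (if even n then 0 else 1)"
  by (induction n) (auto simp: alt_sum_Suc)

section \<open>Expansion for one, two and three columns\<close>

lemma cullis_form_0_rows: "cullis_form 0 (Suc k) f = 0"
  unfolding cullis_form_def cullis_det_def index_sets_def by (auto intro!: sum.neutral)

lemma cullis_form_0_columns: "cullis_form n 0 f = (1 :: 'a :: comm_ring_1)"
proof -
  have "index_sets n 0 = {{}}"
    unfolding index_sets_def by (auto simp: card_eq_0_iff intro: finite_subset)
  then show ?thesis
    unfolding cullis_form_altdef by (simp add: cullis_sign_def)
qed

lemma cullis_form_split_last_entry:
  assumes "j < k"
  shows "cullis_form m k f = cullis_form m k (f(j := (f j)(n := 0))) + f j n * cullis_form m k (f(j := unit_col n))"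
proof -
  have "f = f(j := \<lambda>i. 1 * ((f j)(n := 0)) i + f j n * unit_col n i)"
    by (auto simp: fun_eq_iff)
  then show ?thesis
    using cullis_form_linear_combination[OF assms, of m f 1 "(f j)(n := 0)" "f j n" "unit_col n"] by simp
qed

lemma cullis_form_one_column: "cullis_form n 1 f = alt_sum n (f 0)"
proof (induction n)
  case 0
  show ?case
    using cullis_form_0_rows[of 0 f] by simp
next
  case (Suc n)
  have "cullis_form (Suc n) 1 (f(0 := (f 0)(n := 0))) = cullis_form n 1 (f(0 := (f 0)(n := 0)))"
    by (rule cullis_form_zero_last_row) simp
  also have "\<dots> = cullis_form n 1 f"
    by (rule cullis_form_cong) simp
  finally show ?case
    using cullis_form_split_last_entry[of 0 1 "Suc n" f n] cullis_form_unit_last_column[of n 0 f] Suc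
    by (simp add: cullis_form_0_columns alt_sum_Suc)
qed

text \<open>The entry in row \<open>n\<close> is split off from both columns. The term with two unit
  columns vanishes, and each mixed term is, up to sign, the one-column form of the other
  column.\<close>

lemma wedge2_Suc:
  "wedge2 (Suc n) x y = wedge2 n x y + (- 1) ^ n * (x n * alt_sum n y - y n * alt_sum n x)"
proof -
  let ?z = "(\<lambda>_ _. 0) :: nat \<Rightarrow> nat \<Rightarrow> 'a"
  let ?x = "x(n := 0)" and ?y = "y(n := 0)" and ?e = "unit_col n :: nat \<Rightarrow> 'a"
  let ?w = "\<lambda>u v. cullis_form (Suc n) 2 (?z(0 := u, 1 := v))"
  have 1: "?w x v = ?w ?x v + x n * ?w ?e v" for v
    using cullis_form_split_last_entry[of 0 2 "Suc n" "?z(0 := x, 1 := v)" n] by (simp add: fun_upd_twist)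
  have 2: "?w u y = ?w u ?y + y n * ?w u ?e" for u
    using cullis_form_split_last_entry[of 1 2 "Suc n" "?z(0 := u, 1 := y)" n] by simp
  have 3: "?w ?e ?e = 0"
    by (rule cullis_form_equal_columns[of 0 _ 1]) auto
  have 4: "?w ?e ?y = - ?w ?y ?e"
    by (rule cullis_form_swap_columns) auto
  have 5: "?w u ?e = - ((- 1) ^ n * alt_sum n u)" for u
    using cullis_form_unit_last_column[of n 1 "?z(0 := u)"] cullis_form_one_column[of n "?z(0 := u)"]
    by (simp add: numeral_2_eq_2)
  have 6: "?w ?x ?y = wedge2 n x y"
  proof -
    have "?w ?x ?y = cullis_form n 2 (?z(0 := ?x, 1 := ?y))"
      by (rule cullis_form_zero_last_row) (auto simp: less_2_cases_iff)
    also have "\<dots> = wedge2 n x y"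
      unfolding wedge2_def by (rule cullis_form_cong) (auto simp: less_2_cases_iff)
    finally show ?thesis .
  qed
  have 7: "alt_sum n ?x = alt_sum n x" "alt_sum n ?y = alt_sum n y"
    by (auto intro: alt_sum_cong)
  show ?thesis
    unfolding wedge2_def[of "Suc n"] 1 2 3 4 5 6 7 by (simp add: algebra_simps)
qed

lemma wedge2_0: "wedge2 0 x y = 0"
  unfolding wedge2_def using cullis_form_0_rows[of 1] by (simp add: numeral_2_eq_2)

lemma wedge2_linear_right:
  "wedge2 n x (\<lambda>i. a * y i + b * z i) = a * wedge2 n x y + b * wedge2 n x z"
  unfolding wedge2_def by (rule cullis_form_linear_combination) simp

lemma wedge2_swap: "wedge2 n x y = - wedge2 n y x"
  unfolding wedge2_def by (rule cullis_form_swap_columns) auto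

lemma wedge2_linear_left:
  "wedge2 n (\<lambda>i. a * y i + b * z i) x = a * wedge2 n y x + b * wedge2 n z x"
  using wedge2_linear_right[of n x a y b z] by (simp add: wedge2_swap[of n _ x])

lemma wedge3_Suc:
  "wedge3 (Suc n) x y z = wedge3 n x y z +
     (- 1) ^ n * (x n * wedge2 n y z + y n * wedge2 n z x + z n * wedge2 n x y)"
proof -
  let ?o = "(\<lambda>_ _. 0) :: nat \<Rightarrow> nat \<Rightarrow> 'a"
  let ?x = "x(n := 0)" and ?y = "y(n := 0)" and ?z = "z(n := 0)"
  let ?e = "unit_col n :: nat \<Rightarrow> 'a"
  let ?w = "\<lambda>u v w. cullis_form (Suc n) 3 (?o(0 := u, 1 := v, 2 := w))"
  have 1: "?w x v w = ?w ?x v w + x n * ?w ?e v w" for v w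
    using cullis_form_split_last_entry[of 0 3 "Suc n" "?o(0 := x, 1 := v, 2 := w)" n]
    by (simp add: fun_upd_twist)
  have 2: "?w u y w = ?w u ?y w + y n * ?w u ?e w" for u w
    using cullis_form_split_last_entry[of 1 3 "Suc n" "?o(0 := u, 1 := y, 2 := w)" n]
    by (simp add: fun_upd_twist)
  have 3: "?w u v z = ?w u v ?z + z n * ?w u v ?e" for u v
    using cullis_form_split_last_entry[of 2 3 "Suc n" "?o(0 := u, 1 := v, 2 := z)" n] by simp
  have 4: "?w ?e ?e u = 0" "?w ?e u ?e = 0" "?w u ?e ?e = 0" for u
    using cullis_form_equal_columns[of 0 3 1 "Suc n" "?o(0 := ?e, 1 := ?e, 2 := u)"]
      cullis_form_equal_columns[of 0 3 2 "Suc n" "?o(0 := ?e, 1 := u, 2 := ?e)"]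
      cullis_form_equal_columns[of 1 3 2 "Suc n" "?o(0 := u, 1 := ?e, 2 := ?e)"] by simp_all
  have 5: "?w u v ?e = (- 1) ^ n * wedge2 n u v" for u v
    using cullis_form_unit_last_column[of n 2 "?o(0 := u, 1 := v)"] by (simp add: wedge2_def numeral_3_eq_3)
  have 6: "?w u ?e v = (- 1) ^ n * wedge2 n v u" for u v
  proof -
    have "?w u ?e v = - ?w u v ?e"
      using cullis_form_swap_columns[of 1 3 2 "Suc n" "?o(0 := u)" ?e v] by simp
    then show ?thesis
      unfolding 5 by (simp add: wedge2_swap[of n u v])
  qed
  have 7: "?w ?e u v = (- 1) ^ n * wedge2 n u v" for u v
  proof -
    have "?w ?e u v = - ?w u ?e v"
      using cullis_form_swap_columns[of 0 3 1 "Suc n" "?o(2 := v)" ?e u] by (simp add: fun_upd_twist)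
    then show ?thesis
      unfolding 6 by (simp add: wedge2_swap[of n v u])
  qed
  have 8: "?w ?x ?y ?z = wedge3 n x y z"
  proof -
    have "?w ?x ?y ?z = cullis_form n 3 (?o(0 := ?x, 1 := ?y, 2 := ?z))"
      by (rule cullis_form_zero_last_row) (auto simp: less_Suc_eq numeral_3_eq_3)
    also have "\<dots> = wedge3 n x y z"
      unfolding wedge3_def by (rule cullis_form_cong) (auto simp: less_Suc_eq numeral_3_eq_3)
    finally show ?thesis .
  qed
  have 9: "wedge2 n (u(n := 0)) v = wedge2 n u v" "wedge2 n v (u(n := 0)) = wedge2 n v u"
    for u v :: "nat \<Rightarrow> 'a"
    unfolding wedge2_def by (auto intro!: cullis_form_cong simp: less_2_cases_iff)
  show ?thesis
    unfolding wedge3_def[of "Suc n"] 1 2 3 4 5 6 7 8 9 by (simp add: algebra_simps)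
qed

text \<open>The 3-form is the exterior product of \<open>alt_sum n\<close> and
  \<open>wedge2 n\<close>. In the induction on the rows the extra products cancel in pairs, whatever
  the parity of \<open>n\<close>.\<close>

lemma wedge3_altdef:
  "wedge3 n x y z = alt_sum n x * wedge2 n y z + alt_sum n y * wedge2 n z x + alt_sum n z * wedge2 n x y"
proof (induction n)
  case 0
  show ?case
    unfolding wedge3_def using cullis_form_0_rows[of 2] by (simp add: numeral_3_eq_3)
next
  case (Suc n)
  show ?case
    unfolding wedge3_Suc Suc alt_sum_Suc wedge2_Suc
    by (simp add: algebra_simps flip: power_add)
qed

lemma wedge2_one: "wedge2 n x (\<lambda>_. 1) = (if even n then alt_sum n x else 0)"
  by (induction n) (auto simp: wedge2_0 wedge2_Suc alt_sum_Suc alt_sum_one algebra_simps)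

text \<open>Up to the sign of row \<open>i\<close>, this is the alternating sum of the entries below
  row \<open>i\<close> minus that of the entries above it.\<close>

lemma wedge2_unit_col:
  assumes "i < n"
  shows "wedge2 n w (unit_col i) = (- 1) ^ i * (alt_sum n w - alt_sum i w - alt_sum (Suc i) w)"
  using assms
proof (induction n)
  case (Suc n)
  show ?case
  proof (cases "i = n")
    case True
    have "wedge2 n w (unit_col n) = 0"
      unfolding wedge2_def by (rule cullis_form_zero_column[of 1]) auto
    then show ?thesis
      using True by (simp add: wedge2_Suc alt_sum_unit_col alt_sum_Suc)
  next
    case False
    with Suc have "i < n"
      by simp
    with Suc.IH show ?thesis
      by (simp add: wedge2_Suc alt_sum_unit_col alt_sum_Suc algebra_simps)
  qed
qed simp

text \<open>
  For odd \<open>m\<close> the kernel of \<^const>\<open>wedge2\<close> is spanned by the constant vector, on which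
  \<^const>\<open>alt_sum\<close> is 1; evaluating the contraction there isolates \<open>wedge2 m x y\<close>.
\<close>

lemma wedge3_contraction:
  fixes x y :: "nat \<Rightarrow> 'a :: field"
  assumes "odd m" and zero: "\<And>z. wedge3 m x y z = 0" and "i < m"
  shows "alt_sum m x * y i = alt_sum m y * x i"
proof -
  \<comment> \<open>With \<open>wedge2 m x y = 0\<close> the contraction of the 3-form becomes
    \<open>wedge2 m w\<close>, and also \<open>alt_sum m w = 0\<close>. It remains to see that such
    a \<open>w\<close> is zero.\<close>
  define w where "w = (\<lambda>i. alt_sum m x * y i + (- alt_sum m y) * x i)"
  have xy: "wedge2 m x y = 0"
    using zero[of "\<lambda>_. 1"] \<open>odd m\<close> wedge2_swap[of m "\<lambda>_. 1" x]
    by (simp add: wedge3_altdef alt_sum_one wedge2_one)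
  have w0: "wedge2 m w z = 0" for z
    using zero[of z] unfolding wedge3_altdef xy w_def wedge2_linear_left
    by (simp add: wedge2_swap[of m x z])
  have aw: "alt_sum m w = 0"
    unfolding w_def alt_sum_linear_combination by simp
  have *: "alt_sum (Suc l) w = - alt_sum l w" if "l < m" for l
    using w0[of "unit_col l"] aw unfolding wedge2_unit_col[OF that]
    by (simp add: eq_neg_iff_add_eq_0 add.commute)
  have **: "alt_sum l w = 0" if "l \<le> m" for l
    using that by (induction l) (auto simp: *)
  have "w i = 0"
    using **[of i] **[of "Suc i"] \<open>i < m\<close> by (simp add: alt_sum_Suc)
  then show ?thesis
    by (simp add: w_def)
qed

text \<open>If \<open>x\<close> alone annihilates the form, every \<open>y\<close> may be used in
  \<open>dep\<close>. A \<open>y\<close> with alternating sum 0 and a nonzero entry gives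
  \<open>alt_sum m x = 0\<close>, and then a unit column gives \<open>x = 0\<close>. Keeping
  \<open>dep\<close> as a hypothesis lets the lemma serve inside the induction that proves
  it.\<close>

lemma cullis_form_nondegenerate_if_contraction:
  fixes x y :: "nat \<Rightarrow> 'a :: field"
  assumes dep: "\<And>x y i. (\<And>f. cullis_form n k (f(0 := x, 1 := y)) = 0) \<Longrightarrow> i < n \<Longrightarrow>
      alt_sum m x * y i = alt_sum m y * (x :: nat \<Rightarrow> 'a) i"
    and "2 \<le> m" "m \<le> n" and zero: "\<And>f. cullis_form n k (f(0 := x)) = 0" and "i < n"
  shows "x i = 0"
proof -
  have *: "alt_sum m x * y i = alt_sum m y * x i" if "i < n" for y i
    using that by (rule dep[rotated]) (metis fun_upd_twist zero zero_neq_one)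
  have **: "alt_sum m (\<lambda>i. 1 * unit_col 0 i + 1 * unit_col 1 i) = (0 :: 'a)"
    unfolding alt_sum_linear_combination alt_sum_unit_col using \<open>2 \<le> m\<close> by simp
  have "alt_sum m x = 0"
    using *[of 0 "\<lambda>i. 1 * unit_col 0 i + 1 * unit_col 1 i"] assms(2,3) unfolding ** by simp
  then show ?thesis
    using *[of i "unit_col 0"] \<open>i < n\<close> assms(2) by (simp add: alt_sum_unit_col)
qed

text \<open>Induction on \<open>j\<close>: a unit last column reduces to the previous size and
  settles all entries but the last. A failure in the last entry would force both alternating sums to
  vanish, and then both sides of the relation are 0.\<close>

lemma cullis_form_contraction:
  fixes x y :: "nat \<Rightarrow> 'a :: field"
  assumes "odd m" "3 \<le> m" and "\<And>f. cullis_form (m + j) (3 + j) (f(0 := x, 1 := y)) = 0" and "i < m + j"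
  shows "alt_sum m x * y i = alt_sum m y * x i"
  using assms(3,4)
proof (induction j arbitrary: x y i)
  case 0
  show ?case
  proof (rule wedge3_contraction[OF \<open>odd m\<close>])
    fix z
    have "wedge3 m x y z = cullis_form m 3 (((\<lambda>_ _. 0)(2 := z))(0 := x, 1 := y))"
      unfolding wedge3_def by (rule cullis_form_cong) auto
    then show "wedge3 m x y z = 0"
      using 0(1)[of "(\<lambda>_ _. 0)(2 := z)"] by (simp only: add_0_right)
  qed (use 0 in simp)
next
  case (Suc j)
  let ?n = "m + j" and ?k = "3 + j"
  have zero: "cullis_form (Suc ?n) (Suc ?k) (f(0 := x, 1 := y)) = 0" for f
    using Suc.prems(1)[of f] by (simp only: add_Suc_right)
  have restrict: "cullis_form ?n ?k f = 0"
    if "cullis_form (Suc ?n) (Suc ?k) (f(?k := unit_col ?n)) = 0" for f :: "nat \<Rightarrow> nat \<Rightarrow> 'a"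
    using that unfolding cullis_form_unit_last_column by simp
  have low: "alt_sum m x * y i = alt_sum m y * x i" if "i < ?n" for i
  proof (rule Suc.IH[OF _ that])
    fix f
    have "cullis_form (Suc ?n) (Suc ?k) ((f(?k := unit_col ?n))(0 := x, 1 := y)) = 0"
      by (rule zero)
    then show "cullis_form ?n ?k (f(0 := x, 1 := y)) = 0"
      by (intro restrict) (simp add: fun_upd_twist)
  qed
  \<comment> \<open>The failure makes \<open>alt_sum m u * v - alt_sum m v * u\<close> a nonzero
    multiple of the last unit column. So \<open>u\<close> and that column contract the form to 0,
    hence \<open>u\<close> annihilates the smaller form, and nondegeneracy there makes its first
    \<open>m + j\<close> entries 0.\<close>
  have vanish: "alt_sum m u = 0"
    if z: "\<And>f. cullis_form (Suc ?n) (Suc ?k) (f(0 := u, 1 := v)) = 0"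
      and v: "\<And>i. i < ?n \<Longrightarrow> alt_sum m u * v i = alt_sum m v * u i"
      and ne: "alt_sum m u * v ?n \<noteq> alt_sum m v * u ?n" for u v :: "nat \<Rightarrow> 'a"
  proof -
    define c where "c = alt_sum m u * v ?n - alt_sum m v * u ?n"
    have c: "cullis_form (Suc ?n) (Suc ?k) (f(0 := u, 1 := unit_col ?n)) = 0" for f
    proof -
      let ?w = "\<lambda>i. alt_sum m u * v i + (- alt_sum m v) * u i"
      have "cullis_form (Suc ?n) (Suc ?k) ((f(0 := u))(1 := \<lambda>i. c * unit_col ?n i + 0 * 0)) =
          cullis_form (Suc ?n) (Suc ?k) ((f(0 := u))(1 := ?w))"
        by (rule cullis_form_cong) (use v in \<open>auto simp: c_def less_Suc_eq\<close>)
      also have "\<dots> = alt_sum m u * cullis_form (Suc ?n) (Suc ?k) (f(0 := u, 1 := v)) +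
          (- alt_sum m v) * cullis_form (Suc ?n) (Suc ?k) (f(0 := u, 1 := u))"
        by (rule cullis_form_linear_combination) simp
      also have "\<dots> = 0"
        using z[of f] by (simp add: cullis_form_equal_columns[of 0 _ 1])
      finally have "c * cullis_form (Suc ?n) (Suc ?k) (f(0 := u, 1 := unit_col ?n)) = 0"
        using cullis_form_linear_combination[of 1 "Suc ?k" "Suc ?n" "f(0 := u)" c "unit_col ?n" 0 "\<lambda>_. 0"]
        by simp
      then show ?thesis
        using ne by (simp add: c_def)
    qed
    have "u i = 0" if "i < ?n" for i
    proof (rule cullis_form_nondegenerate_if_contraction[where k = ?k and m = m and n = ?n])
      show "cullis_form ?n ?k (f(0 := u)) = 0" for f
      proof (rule restrict)
        have "cullis_form (Suc ?n) (Suc ?k) ((f(0 := u))(1 := f 1, ?k := unit_col ?n)) =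
            - cullis_form (Suc ?n) (Suc ?k) ((f(0 := u))(1 := unit_col ?n, ?k := f 1))"
          by (rule cullis_form_swap_columns) auto
        also have "\<dots> = - cullis_form (Suc ?n) (Suc ?k) ((f(?k := f 1))(0 := u, 1 := unit_col ?n))"
          by (simp add: fun_upd_twist)
        also have "\<dots> = 0"
          using c by simp
        finally show "cullis_form (Suc ?n) (Suc ?k) (f(0 := u, ?k := unit_col ?n)) = 0"
          by (simp add: fun_upd_idem)
      qed
      show "alt_sum m x * y i = alt_sum m y * x i"
        if "\<And>f. cullis_form ?n ?k (f(0 := x, 1 := y)) = 0" and "i < ?n" for x y :: "nat \<Rightarrow> 'a" and i
        using that by (rule Suc.IH)
    qed (use \<open>3 \<le> m\<close> that in auto)
    then show ?thesis
      by (simp add: alt_sum_def)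
  qed
  have "alt_sum m x * y ?n = alt_sum m y * x ?n"
  proof (rule ccontr)
    assume ne: "alt_sum m x * y ?n \<noteq> alt_sum m y * x ?n"
    have "alt_sum m x = 0"
      by (rule vanish[OF zero low ne])
    moreover have "alt_sum m y = 0"
    proof (rule vanish)
      fix f
      have "cullis_form (Suc ?n) (Suc ?k) (f(0 := y, 1 := x)) = - cullis_form (Suc ?n) (Suc ?k) (f(0 := x, 1 := y))"
        by (rule cullis_form_swap_columns) auto
      then show "cullis_form (Suc ?n) (Suc ?k) (f(0 := y, 1 := x)) = 0"
        using zero by simp
    qed (use low ne in auto)
    ultimately show False
      using ne by simp
  qed
  with low Suc.prems(2) show ?case
    by (auto simp: less_Suc_eq)
qed

lemma cullis_form_nondegenerate:
  fixes x :: "nat \<Rightarrow> 'a :: field"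
  assumes "odd m" "3 \<le> m" and "\<And>f. cullis_form (m + j) (3 + j) (f(0 := x)) = 0" and "i < m + j"
  shows "x i = 0"
proof (rule cullis_form_nondegenerate_if_contraction[where k = "3 + j" and m = m and n = "m + j"])
  show "alt_sum m x * y i = alt_sum m y * x i"
    if "\<And>f. cullis_form (m + j) (3 + j) (f(0 := x, 1 := y)) = 0" and "i < m + j"
    for x y :: "nat \<Rightarrow> 'a" and i
    using that by (rule cullis_form_contraction[OF assms(1,2)])
qed (use assms in auto)

subsection \<open>Polarisation\<close>

definition mix :: "nat set \<Rightarrow> (nat \<Rightarrow> nat \<Rightarrow> 'a) \<Rightarrow> (nat \<Rightarrow> nat \<Rightarrow> 'a) \<Rightarrow> nat \<Rightarrow> nat \<Rightarrow> 'a" where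
  "mix S X Y = (\<lambda>j. if j \<in> S then Y j else X j)"

text \<open>The coefficient of \<open>c ^ r\<close> in the form of \<open>X + c * Y\<close>.\<close>

definition polar :: "nat \<Rightarrow> nat \<Rightarrow> nat \<Rightarrow> (nat \<Rightarrow> nat \<Rightarrow> 'a :: comm_ring_1) \<Rightarrow> (nat \<Rightarrow> nat \<Rightarrow> 'a) \<Rightarrow> 'a" where
  "polar n k r X Y = (\<Sum>S | S \<subseteq> {..<k} \<and> card S = r. cullis_form n k (mix S X Y))"

lemma polar_cong:
  assumes "\<And>j i. j < k \<Longrightarrow> i < n \<Longrightarrow> X j i = X' j i" and "\<And>j i. j < k \<Longrightarrow> i < n \<Longrightarrow> Y j i = Y' j i"
  shows "polar n k r X Y = polar n k r X' Y'"
  unfolding polar_def mix_def using assms by (intro sum.cong refl cullis_form_cong) auto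

text \<open>Expanding a Leibniz product selects a set \<open>S\<close> of columns where the factor
  from \<open>c * Y\<close> is taken; grouping these sets by size collects the powers of
  \<open>c\<close>.\<close>

lemma cullis_form_add_smult:
  "cullis_form n k (\<lambda>j i. X j i + c * Y j i) = (\<Sum>r\<le>k. polar n k r X Y * c ^ r)"
proof -
  let ?P = "\<lambda>I p. cullis_sign k I * signof p :: 'a"
  have prod: "(\<Prod>j<k. X j (q j) + c * Y j (q j)) =
      (\<Sum>S\<in>Pow {..<k}. c ^ card S * (\<Prod>j<k. mix S X Y j (q j)))" for q
  proof -
    have "(\<Prod>j<k. X j (q j) + c * Y j (q j)) = (\<Prod>j<k. c * Y j (q j) + X j (q j))"
      by (simp add: add.commute)
    also have "\<dots> = (\<Sum>S\<in>Pow {..<k}. (\<Prod>j\<in>S. c * Y j (q j)) * (\<Prod>j\<in>{..<k} - S. X j (q j)))"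
      by (rule prod_add) simp
    also have "\<dots> = (\<Sum>S\<in>Pow {..<k}. c ^ card S * (\<Prod>j<k. mix S X Y j (q j)))"
    proof (rule sum.cong[OF refl])
      fix S assume "S \<in> Pow {..<k}"
      then have "(\<Prod>j<k. mix S X Y j (q j)) =
          (\<Prod>j\<in>{..<k} - S. mix S X Y j (q j)) * (\<Prod>j\<in>S. mix S X Y j (q j))"
        by (intro prod.subset_diff) auto
      also have "\<dots> = (\<Prod>j\<in>{..<k} - S. X j (q j)) * (\<Prod>j\<in>S. Y j (q j))"
        by (intro arg_cong2[of _ _ _ _ "(*)"] prod.cong) (auto simp: mix_def)
      finally show "(\<Prod>j\<in>S. c * Y j (q j)) * (\<Prod>j\<in>{..<k} - S. X j (q j)) =
          c ^ card S * (\<Prod>j<k. mix S X Y j (q j))"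
        by (simp add: prod.distrib mult_ac)
    qed
    finally show ?thesis .
  qed
  have "cullis_form n k (\<lambda>j i. X j i + c * Y j i) = (\<Sum>I\<in>index_sets n k. \<Sum>p | p permutes {0..<k}.
      \<Sum>S\<in>Pow {..<k}. c ^ card S * (?P I p * (\<Prod>j<k. mix S X Y j (pick I (p j)))))"
    unfolding cullis_form_leibniz prod sum_distrib_left by (simp add: mult_ac)
  also have "\<dots> = (\<Sum>S\<in>Pow {..<k}. \<Sum>I\<in>index_sets n k. \<Sum>p | p permutes {0..<k}.
      c ^ card S * (?P I p * (\<Prod>j<k. mix S X Y j (pick I (p j)))))"
    by (subst sum.swap, subst (2) sum.swap) (rule refl)
  also have "\<dots> = (\<Sum>S\<in>Pow {..<k}. c ^ card S * cullis_form n k (mix S X Y))"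
    unfolding cullis_form_leibniz sum_distrib_left by (simp add: mult.assoc)
  also have "\<dots> = (\<Sum>r\<le>k. \<Sum>S | S \<in> Pow {..<k} \<and> card S = r. c ^ card S * cullis_form n k (mix S X Y))"
    by (rule sum.group[symmetric]) (auto intro!: card_mono[of "{..<k}", simplified])
  also have "\<dots> = (\<Sum>r\<le>k. polar n k r X Y * c ^ r)"
    unfolding polar_def sum_distrib_right by (intro sum.cong refl) (auto simp: mult.commute)
  finally show ?thesis .
qed

text \<open>The difference has degree at most \<open>k\<close> but vanishes at every scalar.
  Infinite fields form a separate case because \<open>card\<close> is 0 on infinite sets.\<close>

lemma poly_sum_eq_coeffs:
  fixes a b :: "nat \<Rightarrow> 'a :: field"
  assumes "infinite (UNIV :: 'a set) \<or> k < card (UNIV :: 'a set)"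
    and eq: "\<And>c. (\<Sum>r\<le>k. a r * c ^ r) = (\<Sum>r\<le>k. b r * c ^ r)" and "r \<le> k"
  shows "a r = b r"
proof -
  define p where "p = (\<Sum>r\<le>k. monom (a r - b r) r)"
  have coeff: "coeff p r = a r - b r" if "r \<le> k" for r
    using that unfolding p_def by (simp add: coeff_sum)
  have deg: "degree p \<le> k"
    unfolding p_def by (rule degree_sum_le) (auto intro: order.trans[OF degree_monom_le])
  have root: "poly p c = 0" for c
    using eq[of c] unfolding p_def by (simp add: poly_sum poly_monom left_diff_distrib sum_subtractf)
  have "p = 0"
  proof (rule ccontr)
    assume "p \<noteq> 0"
    then have "finite {c. poly p c = 0}" "card {c. poly p c = 0} \<le> degree p"
      by (auto simp: poly_roots_finite intro: card_poly_roots_bound)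
    with root deg assms(1) show False
      by auto
  qed
  with coeff[OF \<open>r \<le> k\<close>] show ?thesis
    by simp
qed

text \<open>Complementing the set of columns exchanges the roles of \<open>X\<close> and
  \<open>Y\<close>.\<close>

lemma polar_commute:
  assumes "r \<le> k"
  shows "polar n k r X Y = polar n k (k - r) Y X"
proof -
  have "polar n k (k - r) Y X = (\<Sum>S | S \<subseteq> {..<k} \<and> card S = r. cullis_form n k (mix ({..<k} - S) Y X))"
    unfolding polar_def
  proof (rule sum.reindex_bij_witness[where i = "\<lambda>S. {..<k} - S" and j = "\<lambda>S. {..<k} - S"])
    fix S assume "S \<in> {S. S \<subseteq> {..<k} \<and> card S = r}"
    then have "S \<subseteq> {..<k}" "card S = r"
      by auto
    then show "{..<k} - S \<in> {S. S \<subseteq> {..<k} \<and> card S = k - r}"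
      using card_Diff_subset[of S "{..<k}"] finite_subset[of S "{..<k}"] by auto
  next
    fix S assume "S \<in> {S. S \<subseteq> {..<k} \<and> card S = k - r}"
    then have "S \<subseteq> {..<k}" "card S = k - r"
      by auto
    then show "{..<k} - S \<in> {S. S \<subseteq> {..<k} \<and> card S = r}"
      using card_Diff_subset[of S "{..<k}"] finite_subset[of S "{..<k}"] assms by auto
  qed (auto simp: double_diff)
  also have "\<dots> = polar n k r X Y"
    unfolding polar_def by (intro sum.cong refl cullis_form_cong) (auto simp: mix_def)
  finally show ?thesis ..
qed

lemma polar_1: "polar n k 1 X Y = (\<Sum>j<k. cullis_form n k (X(j := Y j)))"
proof -
  have "{S. S \<subseteq> {..<k} \<and> card S = 1} = (\<lambda>j. {j}) ` {..<k}"
    by (auto simp: card_1_singleton_iff)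
  then have "polar n k 1 X Y = (\<Sum>j<k. cullis_form n k (mix {j} X Y))"
    unfolding polar_def by (simp add: sum.reindex)
  also have "\<dots> = (\<Sum>j<k. cullis_form n k (X(j := Y j)))"
    by (intro sum.cong refl cullis_form_cong) (auto simp: mix_def)
  finally show ?thesis .
qed

lemma polar_1_sum:
  assumes "finite T"
  shows "polar n k 1 X (\<lambda>j i. \<Sum>s\<in>T. c s * Y s j i) = (\<Sum>s\<in>T. c s * polar n k 1 X (Y s))"
  unfolding polar_1 sum_distrib_left
  by (subst sum.swap) (intro sum.cong refl cullis_form_sum; use assms in simp)

lemma polar_1_linear_combination:
  "polar n k 1 X (\<lambda>j i. a * Y j i + b * Z j i) = a * polar n k 1 X Y + b * polar n k 1 X Z"
  unfolding polar_1 sum_distrib_left sum.distrib[symmetric]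
  by (intro sum.cong refl cullis_form_linear_combination) simp

text \<open>Swapping columns \<open>a\<close> and \<open>l\<close> changes only the sign, and the
  displaced column is arbitrary; a vanishing contraction therefore vanishes at every
  position.\<close>

lemma cullis_form_move_column:
  assumes "a < k" "b < k" "l < k" "a \<noteq> b" "l \<noteq> b" and "\<And>f. cullis_form n k (f(a := x, b := y)) = 0"
  shows "cullis_form n k (f(l := x, b := y)) = 0"
proof (cases "l = a")
  case False
  have "cullis_form n k (f(l := x, b := y)) = cullis_form n k ((f(b := y))(a := f a, l := x))"
    using assms False by (intro cullis_form_cong) auto
  also have "\<dots> = - cullis_form n k ((f(b := y))(a := x, l := f a))"
    using assms False by (intro cullis_form_swap_columns) auto
  also have "(f(b := y))(a := x, l := f a) = (f(l := f a))(a := x, b := y)"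
    using assms False by auto
  finally show ?thesis
    unfolding assms(6) by (simp only: minus_zero)
qed (use assms in auto)

text \<open>Setting column \<open>j\<close> of \<open>X\<close> to 0 leaves only the term in which
  \<open>Y j\<close> replaces it. Thus \<open>Y j\<close> annihilates the form at position
  \<open>j\<close>, and after a swap at position 0.\<close>

lemma polar_1_nondegenerate:
  fixes Y :: "nat \<Rightarrow> nat \<Rightarrow> 'a :: field"
  assumes "odd m" "3 \<le> m" "n = m + q" "k = 3 + q"
    and zero: "\<And>X. polar n k 1 X Y = 0" and "j < k" "i < n"
  shows "Y j i = 0"
proof -
  have *: "cullis_form n k (f(j := Y j)) = 0" for f
  proof -
    have "0 = (\<Sum>l<k. cullis_form n k ((f(j := \<lambda>_. 0))(l := Y l)))"
      using zero[of "f(j := \<lambda>_. 0)"] unfolding polar_1 by (rule sym)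
    also have "\<dots> = (\<Sum>l\<in>{j}. cullis_form n k ((f(j := \<lambda>_. 0))(l := Y l)))"
      using \<open>j < k\<close> by (intro sum.mono_neutral_right) (auto intro!: cullis_form_zero_column[of j])
    finally show ?thesis
      by simp
  qed
  have "cullis_form (m + q) (3 + q) (f(0 := Y j)) = 0" for f
  proof (cases "j = 0")
    case False
    have "cullis_form n k (f(0 := Y j)) = cullis_form n k (f(0 := Y j, j := f j))"
      using False by (intro cullis_form_cong) auto
    also have "\<dots> = - cullis_form n k (f(0 := f j, j := Y j))"
      using False \<open>j < k\<close> by (intro cullis_form_swap_columns) auto
    finally show ?thesis
      using * assms(3,4) by simp
  qed (use * assms(3,4) in auto)
  then show ?thesis
    using cullis_form_nondegenerate[OF assms(1,2)] \<open>i < n\<close> \<open>n = m + q\<close> by blast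
qed

text \<open>A square linear system with trivial kernel is solvable: \<open>S\<close> indexes both
  unknowns and equations, and \<open>h\<close> numbers it so that determinants apply.\<close>

lemma injective_family_spans:
  fixes g :: "'s \<Rightarrow> 's \<Rightarrow> 'a :: field"
  assumes "finite S"
    and kernel: "\<And>c. (\<And>t. t \<in> S \<Longrightarrow> (\<Sum>s\<in>S. c s * g s t) = 0) \<Longrightarrow> \<forall>s\<in>S. c s = 0"
  obtains c where "\<And>t. t \<in> S \<Longrightarrow> (\<Sum>s\<in>S. c s * g s t) = z t"
proof -
  define N where "N = card S"
  obtain h where h: "bij_betw h {0..<N} S"
    using ex_bij_betw_nat_finite[OF assms(1)] unfolding N_def by blast
  let ?h' = "inv_into {0..<N} h"
  define M where "M = mat N N (\<lambda>(i, l). g (h l) (h i))"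
  have M: "M \<in> carrier_mat N N"
    by (simp add: M_def)
  have h': "?h' s < N" "h (?h' s) = s" if "s \<in> S" for s
    using that bij_betw_inv_into_right[OF h that] bij_betwE[OF bij_betw_inv_into[OF h]] by auto
  have eval: "(M *\<^sub>v v) $ ?h' t = (\<Sum>s\<in>S. v $ ?h' s * g s t)"
    if "v \<in> carrier_vec N" "t \<in> S" for v t
  proof -
    have "(M *\<^sub>v v) $ ?h' t = (\<Sum>l\<in>{0..<N}. g (h l) t * v $ l)"
      using that h'[OF that(2)] by (auto simp: M_def scalar_prod_def)
    also have "\<dots> = (\<Sum>l\<in>{0..<N}. v $ ?h' (h l) * g (h l) t)"
      using bij_betw_inv_into_left[OF h] by (intro sum.cong) (auto simp: mult.commute)
    also have "\<dots> = (\<Sum>s\<in>S. v $ ?h' s * g s t)"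
      by (rule sum.reindex_bij_betw[OF h])
    finally show ?thesis .
  qed
  have "det M \<noteq> 0"
  proof
    assume "det M = 0"
    then obtain v where v: "v \<in> carrier_vec N" "v \<noteq> 0\<^sub>v N" "M *\<^sub>v v = 0\<^sub>v N"
      using det_0_iff_vec_prod_zero[OF M] by blast
    have "\<forall>s\<in>S. v $ ?h' s = 0"
      using eval[OF v(1)] h' v(3) by (intro kernel) auto
    then have "v $ l = 0" if "l < N" for l
      using that bij_betw_inv_into_left[OF h, of l] bij_betwE[OF h] by (metis atLeast0LessThan lessThan_iff)
    then have "v = 0\<^sub>v N"
      using v(1) by (intro eq_vecI) auto
    with v(2) show False
      by simp
  qed
  \<comment> \<open>The adjugate divided by the determinant inverts \<open>M\<close>.\<close>
  define w where "w = (1 / det M) \<cdot>\<^sub>v (adj_mat M *\<^sub>v vec N (\<lambda>i. z (h i)))"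
  have adj: "adj_mat M \<in> carrier_mat N N" "M * adj_mat M = det M \<cdot>\<^sub>m 1\<^sub>m N"
    using adj_mat[OF M] by auto
  have w: "w \<in> carrier_vec N"
    using adj by (simp add: w_def)
  have "M *\<^sub>v w = (1 / det M) \<cdot>\<^sub>v ((M * adj_mat M) *\<^sub>v vec N (\<lambda>i. z (h i)))"
    unfolding w_def using M adj(1)
    by (subst assoc_mult_mat_vec[of M N N _ N]) (auto intro!: mult_mat_vec[of M N N])
  also have "\<dots> = vec N (\<lambda>i. z (h i))"
    unfolding adj(2) using \<open>det M \<noteq> 0\<close> by (intro eq_vecI) (auto simp: scalar_prod_smult_left)
  finally have Mw: "M *\<^sub>v w = vec N (\<lambda>i. z (h i))" .
  show thesis
    by (rule that[of "\<lambda>s. w $ ?h' s"]) (use eval[OF w] h' in \<open>auto simp: Mw\<close>)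
qed

section \<open>Linearity and surjectivity from the first polarisation\<close>

context
  fixes m q n k :: nat
  assumes size: "odd m" "3 \<le> m" "n = m + q" "k = 3 + q"
begin

text \<open>Only linearity of the first polarisation in its second argument is available, as neither
  map is assumed linear. Nondegeneracy makes the images of the matrix units under
  \<open>\<psi>\<close> linearly independent, hence a basis by counting; \<open>C\<close> consists
  of the coordinates of \<open>Z\<close> in it.\<close>

lemma polarised_pair_represents:
  fixes \<phi> \<psi> :: "(nat \<Rightarrow> nat \<Rightarrow> 'a :: field) \<Rightarrow> nat \<Rightarrow> nat \<Rightarrow> 'a"
  assumes pres: "\<And>X Y. polar n k 1 (\<phi> X) (\<psi> Y) = polar n k 1 X Y"
  obtains C where "\<And>X. polar n k 1 (\<phi> X) Z = polar n k 1 X C"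
    and "(\<forall>j<k. \<forall>i<n. C j i = 0) \<longrightarrow> (\<forall>j<k. \<forall>i<n. Z j i = 0)"
proof -
  define S where "S = {..<k} \<times> {..<n}"
  define E :: "nat \<times> nat \<Rightarrow> nat \<Rightarrow> nat \<Rightarrow> 'a" where
    "E = (\<lambda>s j i. if (j, i) = s then 1 else 0)"
  have fin: "finite S"
    by (simp add: S_def)
  have E_sum: "(\<Sum>s\<in>S. c s * E s j i) = c (j, i)" if "j < k" "i < n" for c j i
  proof -
    have "(\<Sum>s\<in>S. c s * E s j i) = (\<Sum>s\<in>S. if s = (j, i) then c s else 0)"
      by (rule sum.cong) (auto simp: E_def)
    then show ?thesis
      using that fin by (simp add: S_def)
  qed
  have transport: "polar n k 1 (\<phi> X) (\<lambda>j i. \<Sum>s\<in>S. c s * \<psi> (E s) j i) =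
      polar n k 1 X (\<lambda>j i. \<Sum>s\<in>S. c s * E s j i)" for X c
    unfolding polar_1_sum[OF fin] pres ..
  obtain c where c: "\<And>t. t \<in> S \<Longrightarrow> (\<Sum>s\<in>S. c s * case_prod (\<psi> (E s)) t) = case_prod Z t"
  proof (rule injective_family_spans[OF fin, of "\<lambda>s. case_prod (\<psi> (E s))" "case_prod Z"])
    fix c assume z: "(\<Sum>s\<in>S. c s * case_prod (\<psi> (E s)) t) = 0" if "t \<in> S" for t
    have "polar n k 1 X (\<lambda>j i. \<Sum>s\<in>S. c s * E s j i) = 0" for X
    proof -
      have "polar n k 1 (\<phi> X) (\<lambda>j i. \<Sum>s\<in>S. c s * \<psi> (E s) j i) =
          polar n k 1 (\<phi> X) (\<lambda>j i. \<Sum>s\<in>{}. c s * \<psi> (E s) j i)"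
        using z by (intro polar_cong) (auto simp: S_def)
      then show ?thesis
        unfolding transport unfolding polar_1_sum[OF finite.emptyI] by simp
    qed
    then have "(\<Sum>s\<in>S. c s * E s j i) = 0" if "j < k" "i < n" for j i
      by (rule polar_1_nondegenerate[OF size _ that])
    then show "\<forall>s\<in>S. c s = 0"
      using E_sum by (auto simp: S_def)
  qed blast
  show thesis
  proof (rule that)
    fix X
    have "polar n k 1 (\<phi> X) Z = polar n k 1 (\<phi> X) (\<lambda>j i. \<Sum>s\<in>S. c s * \<psi> (E s) j i)"
      by (rule polar_cong) (use c in \<open>auto simp: S_def\<close>)
    also have "\<dots> = polar n k 1 X (\<lambda>j i. c (j, i))"
      unfolding transport by (intro polar_cong) (auto simp: E_sum)
    finally show "polar n k 1 (\<phi> X) Z = polar n k 1 X (\<lambda>j i. c (j, i))" .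
  next
    show "(\<forall>j<k. \<forall>i<n. c (j, i) = 0) \<longrightarrow> (\<forall>j<k. \<forall>i<n. Z j i = 0)"
      using c by (force simp: S_def sum.neutral)
  qed
qed

text \<open>The images of \<open>\<phi>\<close> suffice as test matrices: \<open>Z - Z'\<close> is
  represented by some \<open>C\<close> that pairs to 0 with every \<open>X\<close>, so
  \<open>C\<close> vanishes, and \<open>Z - Z'\<close> with it.\<close>

lemma polarised_pair_separates:
  fixes \<phi> \<psi> :: "(nat \<Rightarrow> nat \<Rightarrow> 'a :: field) \<Rightarrow> nat \<Rightarrow> nat \<Rightarrow> 'a"
  assumes pres: "\<And>X Y. polar n k 1 (\<phi> X) (\<psi> Y) = polar n k 1 X Y"
    and eq: "\<And>X. polar n k 1 (\<phi> X) Z = polar n k 1 (\<phi> X) Z'" and "j < k" "i < n"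
  shows "Z j i = Z' j i"
proof -
  let ?W = "\<lambda>j i. 1 * Z j i + (- 1) * Z' j i"
  obtain C where C: "\<And>X. polar n k 1 (\<phi> X) ?W = polar n k 1 X C"
    and CW: "(\<forall>j<k. \<forall>i<n. C j i = 0) \<longrightarrow> (\<forall>j<k. \<forall>i<n. ?W j i = 0)"
    by (rule polarised_pair_represents[OF pres, of ?W]) blast
  have "polar n k 1 X C = 0" for X
    unfolding C[symmetric] polar_1_linear_combination eq by simp
  then have "C j i = 0" if "j < k" "i < n" for j i
    by (rule polar_1_nondegenerate[OF size _ that])
  with CW have "?W j i = 0"
    using \<open>j < k\<close> \<open>i < n\<close> by blast
  then show ?thesis
    by simp
qed

lemma polarised_pair_linear:
  fixes \<phi> \<psi> :: "(nat \<Rightarrow> nat \<Rightarrow> 'a :: field) \<Rightarrow> nat \<Rightarrow> nat \<Rightarrow> 'a"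
  assumes pres: "\<And>X Y. polar n k 1 (\<phi> X) (\<psi> Y) = polar n k 1 X Y" and "j < k" "i < n"
  shows "\<psi> (\<lambda>j i. a * Y j i + b * Z j i) j i = a * \<psi> Y j i + b * \<psi> Z j i"
  by (rule polarised_pair_separates[where \<phi> = \<phi> and \<psi> = \<psi>])
    (use assms in \<open>simp_all only: pres polar_1_linear_combination\<close>)

lemma polarised_pair_surjective:
  fixes \<phi> \<psi> :: "(nat \<Rightarrow> nat \<Rightarrow> 'a :: field) \<Rightarrow> nat \<Rightarrow> nat \<Rightarrow> 'a"
  assumes pres: "\<And>X Y. polar n k 1 (\<phi> X) (\<psi> Y) = polar n k 1 X Y"
  obtains C where "\<And>j i. j < k \<Longrightarrow> i < n \<Longrightarrow> \<psi> C j i = Z j i"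
proof -
  obtain C where C: "\<And>X. polar n k 1 (\<phi> X) Z = polar n k 1 X C"
    by (rule polarised_pair_represents[OF pres, of Z]) blast
  have "\<psi> C j i = Z j i" if "j < k" "i < n" for j i
    by (rule polarised_pair_separates[OF pres _ that]) (simp only: C pres)
  then show thesis
    by (rule that)
qed

end

section \<open>The second polarisation and matrices of rank 1\<close>

lemma cullis_form_proportional_columns:
  assumes "a < k" "b < k" "a \<noteq> b"
    and "\<And>i. i < n \<Longrightarrow> f a i = s * v i" "\<And>i. i < n \<Longrightarrow> f b i = t * v i"
  shows "cullis_form n k f = 0"
proof -
  have "cullis_form n k f = cullis_form n k (f(a := \<lambda>i. s * v i + 0 * 0))"
    by (rule cullis_form_cong) (auto simp: assms)
  also have "\<dots> = s * cullis_form n k (f(a := v))"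
    using cullis_form_linear_combination[OF assms(1), of n f s v 0 "\<lambda>_. 0"] by simp
  also have "cullis_form n k (f(a := v)) = cullis_form n k ((f(a := v))(b := \<lambda>i. t * v i + 0 * 0))"
    by (rule cullis_form_cong) (use assms(3) in \<open>auto simp: assms(5)\<close>)
  also have "\<dots> = t * cullis_form n k (f(a := v, b := v))"
    using cullis_form_linear_combination[OF assms(2), of n "f(a := v)" t v 0 "\<lambda>_. 0"] by simp
  also have "cullis_form n k (f(a := v, b := v)) = 0"
    using assms by (intro cullis_form_equal_columns[of a _ b]) auto
  finally show ?thesis
    by simp
qed

definition outer :: "(nat \<Rightarrow> 'a :: comm_ring_1) \<Rightarrow> (nat \<Rightarrow> 'a) \<Rightarrow> nat \<Rightarrow> nat \<Rightarrow> 'a" where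
  "outer v u = (\<lambda>j i. u j * v i)"

lemma polar_2_outer: "polar n k 2 X (outer v u) = 0"
  unfolding polar_def
proof (intro sum.neutral ballI)
  fix S assume "S \<in> {S. S \<subseteq> {..<k} \<and> card S = 2}"
  then obtain a b where "S = {a, b}" "a \<noteq> b" "a < k" "b < k"
    by (auto simp: card_2_iff)
  then show "cullis_form n k (mix S X (outer v u)) = 0"
    by (intro cullis_form_proportional_columns[of a k b n _ "u a" v "u b"]) (auto simp: mix_def outer_def)
qed

text \<open>Any other pair of columns from \<open>Y\<close> leaves one of the zero columns of
  \<open>X\<close> in place.\<close>

lemma polar_2_two_columns:
  assumes "a < k" "b < k" "a \<noteq> b" and "X a = (\<lambda>_. 0)" "X b = (\<lambda>_. 0)"
  shows "polar n k 2 X Y = cullis_form n k (X(a := Y a, b := Y b))"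
proof -
  have "polar n k 2 X Y = (\<Sum>S\<in>{{a, b}}. cullis_form n k (mix S X Y))"
    unfolding polar_def
  proof (rule sum.mono_neutral_right)
    show "finite {S. S \<subseteq> {..<k} \<and> card S = 2}"
      by (rule finite_subset[of _ "Pow {..<k}"]) auto
    show "{{a, b}} \<subseteq> {S. S \<subseteq> {..<k} \<and> card S = 2}"
      using assms by auto
    show "\<forall>S\<in>{S. S \<subseteq> {..<k} \<and> card S = 2} - {{a, b}}. cullis_form n k (mix S X Y) = 0"
    proof
      fix S assume S: "S \<in> {S. S \<subseteq> {..<k} \<and> card S = 2} - {{a, b}}"
      then have "\<not> {a, b} \<subseteq> S"
        using card_subset_eq[of S "{a, b}"] \<open>a \<noteq> b\<close> finite_subset[of S "{..<k}"] by auto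
      then obtain l where "l \<in> {a, b}" "l \<notin> S"
        by blast
      then show "cullis_form n k (mix S X Y) = 0"
        using assms by (intro cullis_form_zero_column[of l]) (auto simp: mix_def)
    qed
  qed
  also have "\<dots> = cullis_form n k (X(a := Y a, b := Y b))"
    using assms by (auto intro!: cullis_form_cong simp: mix_def)
  finally show ?thesis .
qed

lemma cullis_form_contraction_columns:
  assumes zero: "\<And>X. polar n k 2 X Y = 0" and "a < b" "b < k"
  shows "cullis_form n k (f(0 := Y a, 1 := Y b)) = 0"
proof -
  have ab: "cullis_form n k (f(a := Y a, b := Y b)) = 0" for f
  proof -
    have "cullis_form n k ((f(a := \<lambda>_. 0, b := \<lambda>_. 0))(a := Y a, b := Y b)) = 0"
      using assms zero polar_2_two_columns[of a k b "f(a := \<lambda>_. 0, b := \<lambda>_. 0)" n Y] by simp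
    moreover have "(f(a := \<lambda>_. 0, b := \<lambda>_. 0))(a := Y a, b := Y b) = f(a := Y a, b := Y b)"
      using assms by (auto simp: fun_upd_twist)
    ultimately show ?thesis
      by (simp only:)
  qed
  \<comment> \<open>The column at \<open>a\<close> moves to 0 first, which is possible because
    \<open>a < b\<close> keeps \<open>b\<close> away from 0.\<close>
  have "cullis_form n k (f(0 := Y a, b := Y b)) = 0" for f
    by (rule cullis_form_move_column[of a k b 0]) (use assms ab in auto)
  then have b0: "cullis_form n k (f(b := Y b, 0 := Y a)) = 0" for f
    using assms fun_upd_twist[of 0 b f] by (metis not_less_zero)
  have "cullis_form n k (f(1 := Y b, 0 := Y a)) = 0"
    by (rule cullis_form_move_column[of b k 0 1]) (use assms b0 in auto)
  then show ?thesis
    using fun_upd_twist[of 0 1 f] by (metis zero_neq_one)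
qed

text \<open>If some column has nonzero alternating sum, all columns are multiples of it, so
  \<open>Y\<close> has rank 1.\<close>

lemma alt_sum_columns:
  fixes Y :: "nat \<Rightarrow> nat \<Rightarrow> 'a :: field"
  assumes size: "odd m" "3 \<le> m" "n = m + q" "k = 3 + q"
    and zero: "\<And>X. polar n k 2 X Y = 0" and "a < k" "b < k" "i < n"
  shows "alt_sum m (Y a) * Y b i = alt_sum m (Y b) * Y a i"
proof -
  have *: "alt_sum m (Y a) * Y b i = alt_sum m (Y b) * Y a i" if "a < b" "b < k" for a b
  proof (rule cullis_form_contraction[OF size(1,2)])
    show "cullis_form (m + q) (3 + q) (f(0 := Y a, 1 := Y b)) = 0" for f
      using cullis_form_contraction_columns[OF zero that] size by simp
  qed (use \<open>i < n\<close> size in simp)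
  show ?thesis
    using *[of a b] *[of b a] assms by (cases a b rule: linorder_cases) auto
qed

subsection \<open>Linear preservers of the second polarisation\<close>

text \<open>The facts from which the factorisation follows. \<open>wide\<close> yields nonzero
  vectors with vanishing \<open>image_sum\<close>, \<open>third_scalar\<close> serves to find good
  combinations, and \<open>T_cong\<close> says that entries outside the range do not matter.\<close>

locale linear_cullis_preserver =
  fixes m q n k :: nat and T :: "(nat \<Rightarrow> nat \<Rightarrow> 'a :: field) \<Rightarrow> nat \<Rightarrow> nat \<Rightarrow> 'a"
  assumes size: "odd m" "3 \<le> m" "n = m + q" "k = 3 + q"
    and wide: "k < n"
    and third_scalar: "\<exists>c :: 'a. c \<noteq> 0 \<and> c \<noteq> 1"
    and T_cong: "(\<And>j i. j < k \<Longrightarrow> i < n \<Longrightarrow> X j i = Y j i) \<Longrightarrow> T X = T Y"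
    and T_linear: "j < k \<Longrightarrow> i < n \<Longrightarrow>
      T (\<lambda>j i. a * X j i + b * Y j i) j i = a * T X j i + b * T Y j i"
    and T_surjective: "\<exists>X. \<forall>j<k. \<forall>i<n. T X j i = Z j i"
    and T_injective: "(\<And>j i. j < k \<Longrightarrow> i < n \<Longrightarrow> T X j i = 0) \<Longrightarrow> j < k \<Longrightarrow> i < n \<Longrightarrow> X j i = 0"
    and T_polar: "polar n k 2 (T X) (T Y) = polar n k 2 X Y"
begin

section \<open>Images of rank 1 matrices\<close>

lemma m_le_n: "m \<le> n"
  using size by simp

lemma T_sum:
  assumes "finite S" and "j < k" "i < n"
  shows "T (\<lambda>j i. \<Sum>s\<in>S. c s * Y s j i) j i = (\<Sum>s\<in>S. c s * T (Y s) j i)"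
  using assms(1)
proof (induction S)
  case empty
  show ?case
    using T_linear[OF assms(2,3), of 0 "\<lambda>_ _. 0" 0 "\<lambda>_ _. 0"] by simp
next
  case (insert x S)
  then show ?case
    using T_linear[OF assms(2,3), of "c x" "Y x" 1 "\<lambda>j i. \<Sum>s\<in>S. c s * Y s j i"] by simp
qed

definition image :: "(nat \<Rightarrow> 'a) \<Rightarrow> (nat \<Rightarrow> 'a) \<Rightarrow> nat \<Rightarrow> nat \<Rightarrow> 'a" where
  "image v u = T (outer v u)"

text \<open>By \<open>image_sum_quadratic\<close>, whenever this vector is nonzero the image has
  rank 1 and this vector is its row factor.\<close>

definition image_sum :: "(nat \<Rightarrow> 'a) \<Rightarrow> (nat \<Rightarrow> 'a) \<Rightarrow> nat \<Rightarrow> 'a" where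
  "image_sum v u j = alt_sum m (image v u j)"

lemma image_linear_left:
  assumes "j < k" "i < n"
  shows "image (\<lambda>i. a * v i + b * w i) u j i = a * image v u j i + b * image w u j i"
proof -
  have "outer (\<lambda>i. a * v i + b * w i) u = (\<lambda>j i. a * outer v u j i + b * outer w u j i)"
    by (simp add: outer_def fun_eq_iff algebra_simps)
  then show ?thesis
    unfolding image_def using T_linear[OF assms] by simp
qed

lemma image_linear_right:
  assumes "j < k" "i < n"
  shows "image v (\<lambda>j. a * u j + b * w j) j i = a * image v u j i + b * image v w j i"
proof -
  have "outer v (\<lambda>j. a * u j + b * w j) = (\<lambda>j i. a * outer v u j i + b * outer v w j i)"
    by (simp add: outer_def fun_eq_iff algebra_simps)
  then show ?thesis
    unfolding image_def using T_linear[OF assms] by simp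
qed

lemma image_sum_linear_left:
  assumes "j < k"
  shows "image_sum (\<lambda>i. a * v i + b * w i) u j = a * image_sum v u j + b * image_sum w u j"
  unfolding image_sum_def alt_sum_linear_combination[symmetric]
  by (rule alt_sum_cong) (use assms m_le_n in \<open>simp add: image_linear_left\<close>)

lemma image_sum_linear_right:
  assumes "j < k"
  shows "image_sum v (\<lambda>j. a * u j + b * w j) j = a * image_sum v u j + b * image_sum v w j"
  unfolding image_sum_def alt_sum_linear_combination[symmetric]
  by (rule alt_sum_cong) (use assms m_le_n in \<open>simp add: image_linear_right\<close>)

lemma image_expand_left:
  assumes "j < k" "i < n"
  shows "image v u j i = (\<Sum>p<n. v p * image (unit_col p) u j i)"
proof -
  have "image v u j i = T (\<lambda>j i. \<Sum>p<n. v p * outer (unit_col p) u j i) j i"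
    unfolding image_def
    by (subst T_cong[of _ "\<lambda>j i. \<Sum>p<n. v p * outer (unit_col p) u j i"])
      (auto simp: outer_def if_distrib mult.commute cong: if_cong)
  then show ?thesis
    unfolding image_def using T_sum[OF finite_lessThan assms] by simp
qed

lemma image_sum_expand_left:
  assumes "j < k"
  shows "image_sum v u j = (\<Sum>p<n. v p * image_sum (unit_col p) u j)"
proof -
  have "image_sum v u j = alt_sum m (\<lambda>i. \<Sum>p<n. v p * image (unit_col p) u j i)"
    unfolding image_sum_def by (rule alt_sum_cong) (use assms m_le_n image_expand_left in simp)
  also have "\<dots> = (\<Sum>p<n. \<Sum>i<m. (- 1) ^ i * (v p * image (unit_col p) u j i))"
    unfolding alt_sum_def sum_distrib_left by (rule sum.swap)
  also have "\<dots> = (\<Sum>p<n. v p * image_sum (unit_col p) u j)"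
    unfolding image_sum_def alt_sum_def sum_distrib_left by (simp add: mult_ac)
  finally show ?thesis .
qed

lemma T_expand:
  assumes "j < k" "i < n"
  shows "T X j i = (\<Sum>l<k. image (X l) (unit_col l) j i)"
proof -
  have "X j i = (\<Sum>l<k. 1 * outer (X l) (unit_col l) j i)" if "j < k" for j i
  proof -
    have "(\<Sum>l<k. 1 * outer (X l) (unit_col l) j i) = (\<Sum>l<k. if l = j then X l i else 0)"
      by (rule sum.cong) (auto simp: outer_def)
    then show ?thesis
      using that by simp
  qed
  then have "T X j i = T (\<lambda>j i. \<Sum>l<k. 1 * outer (X l) (unit_col l) j i) j i"
    by (subst T_cong[of _ "\<lambda>j i. \<Sum>l<k. 1 * outer (X l) (unit_col l) j i"]) auto
  then show ?thesis
    unfolding image_def T_sum[OF finite_lessThan assms] by simp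
qed

text \<open>Surjectivity carries the vanishing of all second polarisations at
  \<open>outer v u\<close> over to its image, where \<open>alt_sum_columns\<close> applies.\<close>

lemma image_sum_quadratic:
  assumes "a < k" "b < k" "i < n"
  shows "image_sum v u a * image v u b i = image_sum v u b * image v u a i"
  unfolding image_sum_def
proof (rule alt_sum_columns[OF size _ assms])
  fix Z
  obtain X where X: "\<forall>j<k. \<forall>i<n. T X j i = Z j i"
    using T_surjective by blast
  have "polar n k 2 Z (image v u) = polar n k 2 (T X) (T (outer v u))"
    unfolding image_def by (rule polar_cong) (use X in auto)
  then show "polar n k 2 Z (image v u) = 0"
    by (simp add: T_polar polar_2_outer)
qed

text \<open>The quadratic relation is polarised in \<open>v\<close>: matrices with a common
  \<open>u\<close> add up to matrices of the same kind.\<close>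

lemma image_sum_bilinear:
  assumes "a < k" "b < k" "i < n"
  shows "image_sum v u a * image w u b i + image_sum w u a * image v u b i =
    image_sum v u b * image w u a i + image_sum w u b * image v u a i"
proof -
  have "image_sum (\<lambda>i. 1 * v i + 1 * w i) u a * image (\<lambda>i. 1 * v i + 1 * w i) u b i =
      image_sum (\<lambda>i. 1 * v i + 1 * w i) u b * image (\<lambda>i. 1 * v i + 1 * w i) u a i"
    by (rule image_sum_quadratic[OF assms])
  then show ?thesis
    using image_sum_quadratic[OF assms, of v u] image_sum_quadratic[OF assms, of w u] assms
    unfolding image_linear_left[OF assms(1,3)] image_linear_left[OF assms(2,3)]
      image_sum_linear_left[OF assms(1)] image_sum_linear_left[OF assms(2)]
    by (simp add: algebra_simps)
qed

text \<open>There are \<open>n\<close> unknowns and only \<open>k\<close> equations. Padding with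
  zero equations makes the system square; with a trivial kernel it would be solvable for the right
  side 1, which fails at equation \<open>k\<close>.\<close>

lemma image_sum_kernel:
  obtains v p where "p < n" "v p \<noteq> 0" "\<And>a. a < k \<Longrightarrow> image_sum v u a = 0"
proof -
  let ?g = "\<lambda>p a. if a < k then image_sum (unit_col p) u a else 0"
  have "\<not> (\<forall>c. (\<forall>a\<in>{..<n}. (\<Sum>p\<in>{..<n}. c p * ?g p a) = 0) \<longrightarrow> (\<forall>p\<in>{..<n}. c p = 0))"
  proof
    assume kernel: "\<forall>c. (\<forall>a\<in>{..<n}. (\<Sum>p\<in>{..<n}. c p * ?g p a) = 0) \<longrightarrow> (\<forall>p\<in>{..<n}. c p = 0)"
    obtain c where c: "\<And>a. a \<in> {..<n} \<Longrightarrow> (\<Sum>p\<in>{..<n}. c p * ?g p a) = 1"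
      using kernel by (rule_tac injective_family_spans[of "{..<n}" ?g "\<lambda>_. 1"]) auto
    show False
      using c[of k] wide by simp
  qed
  then obtain c p where c: "\<forall>a\<in>{..<n}. (\<Sum>p\<in>{..<n}. c p * ?g p a) = 0" and p: "p < n" "c p \<noteq> 0"
    by auto
  have "image_sum c u a = 0" if "a < k" for a
    using bspec[OF c, of a] that wide by (simp add: image_sum_expand_left[OF that, of c])
  with p show thesis
    by (rule that)
qed

text \<open>
  For \<open>k = 3\<close> some matrices of rank greater than 1 have a vanishing second polar; all of them are
  annihilated by the alternating row sum. For good \<open>u\<close> the image of the space of all \<open>v \<otimes> u\<close>
  is not contained in that exceptional set.
\<close>

definition good :: "(nat \<Rightarrow> 'a) \<Rightarrow> bool" where
  "good u \<longleftrightarrow> (\<exists>v. \<exists>a<k. image_sum v u a \<noteq> 0)"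

text \<open>
  As \<open>k < n\<close>, some nonzero \<open>v\<^sub>1\<close> has alternating row sum 0; polarising the quadratic relation at
  \<open>v\<^sub>1\<close> forces all images of \<open>v \<otimes> u\<close> to share one row direction \<open>s\<close>.
\<close>

lemma good_factor:
  assumes "good u"
  obtains s b1 where "b1 < k" "s b1 = 1" "\<And>v b i. b < k \<Longrightarrow> i < n \<Longrightarrow> image v u b i = s b * image v u b1 i"
proof -
  obtain v0 a0 where a0: "a0 < k" "image_sum v0 u a0 \<noteq> 0"
    using assms unfolding good_def by blast
  obtain l where l: "l < k" "u l \<noteq> 0"
  proof (rule ccontr)
    assume "\<not> thesis"
    with that have "u l = 0" if "l < k" for l
      using that by blast
    then have "image v0 u = T (\<lambda>j i. 0 * 0 + 0 * 0)"
      unfolding image_def by (intro T_cong) (auto simp: outer_def)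
    then have "image v0 u a0 i = 0" if "i < n" for i
      using T_linear[OF a0(1) that, of 0 "\<lambda>_ _. 0" 0 "\<lambda>_ _. 0"] by simp
    then have "image_sum v0 u a0 = 0"
      unfolding image_sum_def alt_sum_def using m_le_n by (intro sum.neutral) auto
    with a0 show False
      by simp
  qed
  obtain v1 p where p: "p < n" "v1 p \<noteq> 0" and t1: "\<And>a. a < k \<Longrightarrow> image_sum v1 u a = 0"
    by (rule image_sum_kernel[of u]) blast
  obtain b1 i1 where b1: "b1 < k" "i1 < n" "image v1 u b1 i1 \<noteq> 0"
  proof (rule ccontr)
    assume "\<not> thesis"
    with that have "T (outer v1 u) j i = 0" if "j < k" "i < n" for j i
      using that unfolding image_def by blast
    from T_injective[OF this l(1) p(1)] l p show False
      by (simp add: outer_def)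
  qed
  \<comment> \<open>For \<open>w\<close> with vanishing \<open>image_sum\<close>, half of the
    polarised relation disappears: \<open>image_sum v u\<close> is proportional to every nonzero row
    of the image of \<open>w\<close>.\<close>
  have kernel: "image_sum v u a * image w u b i = image_sum v u b * image w u a i"
    if "\<And>a. a < k \<Longrightarrow> image_sum w u a = 0" "a < k" "b < k" "i < n" for v w a b i
    using image_sum_bilinear[OF that(2-4), of v u w] that(1)[OF that(2)] that(1)[OF that(3)] by simp
  have s1: "image_sum v0 u b1 \<noteq> 0"
    using kernel[OF t1 a0(1) b1(1,2), of v0] a0(2) b1(3) by auto
  have main: "image_sum v0 u b1 * image v u b i = image_sum v0 u b * image v u b1 i" if "b < k" "i < n" for v b i
  proof -
    \<comment> \<open>Subtracting \<open>c\<close> times \<open>v0\<close> kills entry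
      \<open>b1\<close> of the sum vector. As all sum vectors are proportional to row
      \<open>i1\<close> of the image of \<open>v1\<close>, the other entries vanish too.\<close>
    define c where "c = image_sum v u b1 / image_sum v0 u b1"
    define w where "w = (\<lambda>i. 1 * v i + (- c) * v0 i)"
    have tv: "image_sum v u a = c * image_sum v0 u a" if "a < k" for a
    proof -
      have "image_sum v u a * image v1 u b1 i1 = image_sum v u b1 * image v1 u a i1"
        by (rule kernel[OF t1 that b1(1,2)])
      moreover have "image_sum v0 u a * image v1 u b1 i1 = image_sum v0 u b1 * image v1 u a i1"
        by (rule kernel[OF t1 that b1(1,2)])
      ultimately have "(image_sum v u a * image v1 u b1 i1) * image_sum v0 u b1 = image_sum v u b1 * (image_sum v0 u a * image v1 u b1 i1)"
        by (simp only: mult_ac)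
      then have "(image_sum v u a * image_sum v0 u b1) * image v1 u b1 i1 = (image_sum v u b1 * image_sum v0 u a) * image v1 u b1 i1"
        by (simp only: mult_ac)
      with b1(3) have "image_sum v u a * image_sum v0 u b1 = image_sum v u b1 * image_sum v0 u a"
        by simp
      then show ?thesis
        using s1 by (simp add: c_def field_simps)
    qed
    have tw: "image_sum w u a = 0" if "a < k" for a
      unfolding w_def image_sum_linear_left[OF that] tv[OF that] by simp
    have Pv: "image v u a i = image w u a i + c * image v0 u a i" if "a < k" for a
      unfolding w_def image_linear_left[OF that \<open>i < n\<close>] by simp
    have "image_sum v0 u b1 * image w u b i = image_sum v0 u b * image w u b1 i"
      by (rule kernel[OF tw b1(1) that])
    moreover have "image_sum v0 u b1 * image v0 u b i = image_sum v0 u b * image v0 u b1 i"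
      by (rule image_sum_quadratic[OF b1(1) that])
    ultimately show ?thesis
      unfolding Pv[OF b1(1)] Pv[OF \<open>b < k\<close>] by (simp add: algebra_simps)
  qed
  show thesis
  proof (rule that[of b1 "\<lambda>b. image_sum v0 u b / image_sum v0 u b1"])
    show "image v u b i = image_sum v0 u b / image_sum v0 u b1 * image v u b1 i" if "b < k" "i < n" for v b i
      using main[OF that, of v] s1 by (simp add: field_simps)
  qed (use b1 s1 in auto)
qed

section \<open>A basis of good vectors\<close>

lemma good_nonzero:
  assumes "good u" and "b1 < k" and "\<And>v b i. b < k \<Longrightarrow> i < n \<Longrightarrow> image v u b i = s b * image v u b1 i"
  obtains v i where "i < n" "image v u b1 i \<noteq> 0"
proof (rule ccontr)
  assume "\<not> thesis"
  with that have "image v u b1 i = 0" if "i < n" for v i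
    using that by blast
  with assms(3) have "image v u a i = 0" if "a < k" "i < n" for v a i
    using that by simp
  then have "image_sum v u a = 0" if "a < k" for v a
    unfolding image_sum_def alt_sum_def using m_le_n that by (intro sum.neutral) auto
  with \<open>good u\<close> show False
    unfolding good_def by blast
qed

text \<open>Otherwise every column in the range of \<open>T\<close> would have alternating sum 0,
  against surjectivity: the first unit column has alternating sum 1.\<close>

lemma good_unit_col:
  obtains l where "l < k" "good (unit_col l)"
proof (rule ccontr)
  assume "\<not> thesis"
  with that have bad: "image_sum v (unit_col l) a = 0" if "l < k" "a < k" for v l a
    using that unfolding good_def by blast
  obtain X where X: "\<forall>j<k. \<forall>i<n. T X j i = unit_col 0 i"
    using T_surjective[of "\<lambda>_. unit_col 0"] by blast
  have "0 < k"
    using size by simp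
  have "(1 :: 'a) = alt_sum m (unit_col 0)"
    using size by (simp add: alt_sum_unit_col)
  also have "\<dots> = alt_sum m (\<lambda>i. \<Sum>l<k. image (X l) (unit_col l) 0 i)"
    by (rule alt_sum_cong) (use X m_le_n \<open>0 < k\<close> T_expand[OF \<open>0 < k\<close>, of _ X] in auto)
  also have "\<dots> = (\<Sum>l<k. image_sum (X l) (unit_col l) 0)"
    unfolding image_sum_def alt_sum_def sum_distrib_left by (rule sum.swap)
  also have "\<dots> = 0"
    using bad \<open>0 < k\<close> by (intro sum.neutral) auto
  finally show False
    by simp
qed

text \<open>The sums of the combination are affine in its coefficient. If they vanished at two
  distinct nonzero scalars, their slope, the sums of \<open>w\<close>, would be 0.\<close>

lemma good_combination:
  assumes "good w"
  obtains c where "c \<noteq> 0" "good (\<lambda>j. 1 * u j + c * w j)"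
proof (rule ccontr)
  assume "\<not> thesis"
  with that have "\<not> good (\<lambda>j. 1 * u j + c * w j)" if "c \<noteq> 0" for c
    using that by blast
  then have bad: "image_sum v u a + c * image_sum v w a = 0" if "c \<noteq> 0" "a < k" for v a c
    using that image_sum_linear_right[OF that(2), of v 1 u c w] unfolding good_def mult_1_left by metis
  obtain c :: 'a where c: "c \<noteq> 0" "c \<noteq> 1"
    using third_scalar by blast
  have "image_sum v w a = 0" if "a < k" for v a
  proof -
    have "image_sum v u a + c * image_sum v w a = image_sum v u a + 1 * image_sum v w a"
      using bad[OF c(1) that, of v] bad[OF one_neq_zero that, of v] by simp
    then show ?thesis
      using c(2) by simp
  qed
  with \<open>good w\<close> show False
    unfolding good_def by blast
qed

text \<open>A bad unit vector becomes good when a good one is added, since it contributes nothing to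
  the sums. The coefficient \<open>d\<close> is -1 in that case and 0 otherwise.\<close>

lemma good_basis:
  obtains u :: "nat \<Rightarrow> nat \<Rightarrow> 'a" and l0 where "l0 < k" "u l0 = unit_col l0" "\<And>l. l < k \<Longrightarrow> good (u l)"
    "\<And>l. l < k \<Longrightarrow> \<exists>d. unit_col l = (\<lambda>j. 1 * u l j + d * u l0 j)"
proof -
  obtain l0 where l0: "l0 < k" "good (unit_col l0)"
    by (rule good_unit_col)
  define u :: "nat \<Rightarrow> nat \<Rightarrow> 'a" where
    "u = (\<lambda>l. if good (unit_col l) then unit_col l else (\<lambda>j. 1 * unit_col l j + 1 * unit_col l0 j))"
  show thesis
  proof (rule that[of l0 u])
    show "good (u l)" if "l < k" for l
    proof (cases "good (unit_col l)")
      case False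
      obtain v a where "a < k" "image_sum v (unit_col l0) a \<noteq> 0"
        using l0 unfolding good_def by blast
      moreover have "image_sum v (unit_col l) a = 0"
        using False \<open>a < k\<close> unfolding good_def by blast
      ultimately have "image_sum v (\<lambda>j. 1 * unit_col l j + 1 * unit_col l0 j) a \<noteq> 0"
        using image_sum_linear_right[of a v 1 "unit_col l" 1 "unit_col l0"] by simp
      then show ?thesis
        using False \<open>a < k\<close> unfolding good_def u_def by auto
    qed (simp add: u_def)
    show "\<exists>d. unit_col l = (\<lambda>j. 1 * u l j + d * u l0 j)" for l
    proof (cases "good (unit_col l)")
      case True
      then show ?thesis
        by (intro exI[of _ 0]) (simp add: u_def)
    next
      case False
      then show ?thesis
        using l0 by (intro exI[of _ "- 1"]) (auto simp: u_def fun_eq_iff)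
    qed
  qed (use l0 in \<open>auto simp: u_def\<close>)
qed

text \<open>On \<open>outer v (u l)\<close> the map is a linear image of \<open>v\<close> times a
  fixed row factor \<open>s l\<close>. Independence of the row factors forces the linear maps for
  different \<open>l\<close> to be multiples of a single \<open>A\<close>; returning to unit vectors
  gives \<open>R\<close>.\<close>

theorem two_sided_multiplication:
  "\<exists>A R. \<forall>X j i. j < k \<longrightarrow> i < n \<longrightarrow> T X j i = (\<Sum>l<k. (\<Sum>p<n. A i p * X l p) * R l j)"
proof -
  obtain u :: "nat \<Rightarrow> nat \<Rightarrow> 'a" and l0 where l0: "l0 < k" "u l0 = unit_col l0"
    and good: "\<And>l. l < k \<Longrightarrow> good (u l)"
    and basis: "\<And>l. l < k \<Longrightarrow> \<exists>d. unit_col l = (\<lambda>j. 1 * u l j + d * u l0 j)"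
    by (rule good_basis) blast
  have "\<exists>s b1. b1 < k \<and> s b1 = 1 \<and> (\<forall>v b i. b < k \<longrightarrow> i < n \<longrightarrow> image v (u l) b i = s b * image v (u l) b1 i)"
    if "l < k" for l
    by (rule good_factor[OF good[OF that]]) blast
  then obtain s \<beta> where \<beta>: "\<And>l. l < k \<Longrightarrow> \<beta> l < k" and s: "\<And>l. l < k \<Longrightarrow> s l (\<beta> l) = 1"
    and factor: "\<And>l v b i. l < k \<Longrightarrow> b < k \<Longrightarrow> i < n \<Longrightarrow> image v (u l) b i = s l b * image v (u l) (\<beta> l) i"
    by metis
  \<comment> \<open>Every row of \<open>T X\<close> lies in the span of the row factors, here
    expressed through the functionals \<open>g\<close> annihilating them.\<close>
  have T_unit: "(\<Sum>b<k. g b * T X b i) = 0"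
    if "\<And>l. l < k \<Longrightarrow> (\<Sum>b<k. g b * s l b) = 0" "i < n" for g X i
  proof -
    have Pu: "(\<Sum>b<k. g b * image v (u l) b i) = 0" if "l < k" for v l
    proof -
      have "(\<Sum>b<k. g b * image v (u l) b i) = (\<Sum>b<k. g b * s l b) * image v (u l) (\<beta> l) i"
        unfolding sum_distrib_right using factor[OF \<open>l < k\<close> _ \<open>i < n\<close>, of _ v]
        by (intro sum.cong) (auto simp: mult.assoc)
      then show ?thesis
        using \<open>\<And>l. l < k \<Longrightarrow> (\<Sum>b<k. g b * s l b) = 0\<close> \<open>l < k\<close> by simp
    qed
    have Punit: "(\<Sum>b<k. g b * image v (unit_col l) b i) = 0" if "l < k" for v l
    proof -
      obtain d where d: "unit_col l = (\<lambda>j. 1 * u l j + d * u l0 j)"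
        using basis \<open>l < k\<close> by blast
      have "(\<Sum>b<k. g b * image v (unit_col l) b i) =
          (\<Sum>b<k. g b * image v (u l) b i) + d * (\<Sum>b<k. g b * image v (u l0) b i)"
        unfolding d sum_distrib_left sum.distrib[symmetric] using \<open>i < n\<close>
        by (intro sum.cong refl) (simp add: image_linear_right[where a = 1, simplified] algebra_simps)
      then show ?thesis
        unfolding Pu[OF that] Pu[OF l0(1)] by simp
    qed
    have "(\<Sum>b<k. g b * T X b i) = (\<Sum>b<k. \<Sum>l<k. g b * image (X l) (unit_col l) b i)"
      using \<open>i < n\<close> by (intro sum.cong) (auto simp: T_expand sum_distrib_left)
    also have "\<dots> = (\<Sum>l<k. \<Sum>b<k. g b * image (X l) (unit_col l) b i)"
      by (rule sum.swap)
    also have "\<dots> = 0"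
      using Punit by (intro sum.neutral) auto
    finally show ?thesis .
  qed
  \<comment> \<open>As \<open>T\<close> is onto, no nonzero functional annihilates all
    \<open>k\<close> row factors, so they form a basis.\<close>
  have s_injective: "\<forall>b\<in>{..<k}. g b = 0"
    if "\<And>l. l \<in> {..<k} \<Longrightarrow> (\<Sum>b\<in>{..<k}. g b * s l b) = 0" for g
  proof
    fix b assume "b \<in> {..<k}"
    obtain X where X: "\<forall>j<k. \<forall>i<n. T X j i = (if j = b then 1 else 0)"
      using T_surjective[of "\<lambda>j i. if j = b then 1 else 0"] by (rule exE)
    have "0 < n"
      using wide by simp
    have "g b = (\<Sum>c<k. g c * T X c 0)"
    proof -
      have "(\<Sum>c<k. g c * T X c 0) = (\<Sum>c<k. if c = b then g c else 0)"
        using X \<open>0 < n\<close> by (intro sum.cong) auto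
      then show ?thesis
        using \<open>b \<in> {..<k}\<close> by simp
    qed
    also have "\<dots> = 0"
      using that \<open>0 < n\<close> by (intro T_unit) auto
    finally show "g b = 0" .
  qed
  have s_independent: False if "j < k" "j \<noteq> l0" "\<And>b. b < k \<Longrightarrow> s j b = \<nu> * s l0 b" for j \<nu>
  proof -
    obtain c where c: "\<And>l. l \<in> {..<k} \<Longrightarrow> (\<Sum>b\<in>{..<k}. c b * s l b) = (if l = j then 1 else 0)"
      using s_injective
      by (rule_tac injective_family_spans[of "{..<k}" "\<lambda>b l. s l b" "\<lambda>l. if l = j then 1 else 0"]) auto
    have "(1 :: 'a) = (\<Sum>b<k. c b * s j b)"
      using c[of j] that(1) by simp
    also have "\<dots> = \<nu> * (\<Sum>b<k. c b * s l0 b)"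
      unfolding sum_distrib_left using that(3) by (intro sum.cong) auto
    also have "\<dots> = 0"
      using c[of l0] that(2) l0(1) by simp
    finally show False
      by simp
  qed
  define A where "A = (\<lambda>v i. image v (u l0) (\<beta> l0) i)"
  have proportional: "\<exists>\<mu>. \<forall>v i. i < n \<longrightarrow> image v (u j) (\<beta> j) i = \<mu> * A v i" if j: "j < k" for j
  proof (cases "j = l0")
    case True
    then show ?thesis
      by (intro exI[of _ 1]) (simp add: A_def)
  next
    case False
    let ?A' = "\<lambda>v i. image v (u j) (\<beta> j) i"
    \<comment> \<open>The image for this good combination has a single row factor \<open>r\<close>,
      but it is also a sum of products with \<open>s l0\<close> and \<open>s j\<close>; comparing
      the two gives \<open>rel\<close>.\<close>
    obtain c where c: "c \<noteq> 0" "good (\<lambda>l. 1 * u l0 l + c * u j l)"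
      by (rule good_combination[OF good[OF j]])
    obtain r b2 where b2: "b2 < k" and r: "r b2 = 1"
      and Pr: "\<And>v b i. b < k \<Longrightarrow> i < n \<Longrightarrow>
        image v (\<lambda>l. 1 * u l0 l + c * u j l) b i = r b * image v (\<lambda>l. 1 * u l0 l + c * u j l) b2 i"
      by (rule good_factor[OF c(2)]) blast
    have split: "image v (\<lambda>l. 1 * u l0 l + c * u j l) b i = s l0 b * A v i + c * s j b * ?A' v i"
      if "b < k" "i < n" for v b i
      unfolding image_linear_right[OF that] factor[OF l0(1) that] factor[OF j that] by (simp add: A_def)
    have rel: "(s l0 b - r b * s l0 b2) * A v i = - c * (s j b - r b * s j b2) * ?A' v i"
      if "b < k" "i < n" for v b i
      using Pr[OF that, of v] unfolding split[OF that] split[OF b2 that(2)]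
      by (simp add: algebra_simps)
    obtain v0 i0 where A0: "i0 < n" "A v0 i0 \<noteq> 0"
      unfolding A_def by (rule good_nonzero[OF good[OF l0(1)] \<beta>[OF l0(1)] factor[OF l0(1)]])
    obtain v1 i1 where A1: "i1 < n" "?A' v1 i1 \<noteq> 0"
      by (rule good_nonzero[OF good[OF j] \<beta>[OF j] factor[OF j]])
    show ?thesis
    \<comment> \<open>If \<open>s j\<close> is a multiple of \<open>r\<close>, then
      \<open>rel\<close> at a nonzero \<open>A v0 i0\<close> makes \<open>s l0\<close> one too,
      against independence. Otherwise some coefficient of \<open>?A'\<close> is nonzero and can be
      divided out.\<close>
    proof (cases "\<forall>b<k. s j b = r b * s j b2")
      case True
      have "s j b2 \<noteq> 0"
        using True \<beta>[OF j] s[OF j] by fastforce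
      have "s l0 b = r b * s l0 b2" if "b < k" for b
        using rel[OF that A0(1), of v0] True that A0(2) by simp
      then have "s l0 (\<beta> l0) = r (\<beta> l0) * s l0 b2"
        using \<beta>[OF l0(1)] by blast
      then have "s l0 b2 \<noteq> 0"
        using s[OF l0(1)] by auto
      have "s j b = (s j b2 / s l0 b2) * s l0 b" if "b < k" for b
        using True \<open>\<And>b. b < k \<Longrightarrow> s l0 b = r b * s l0 b2\<close> \<open>s l0 b2 \<noteq> 0\<close> that by simp
      with s_independent[OF j False] show ?thesis
        by blast
    next
      case False
      then obtain b where b: "b < k" "s j b - r b * s j b2 \<noteq> 0"
        by auto
      have "?A' v i = (s l0 b - r b * s l0 b2) / (- c * (s j b - r b * s j b2)) * A v i" if "i < n" for v i
        using rel[OF b(1) that, of v] b(2) c(1) by (simp add: field_simps)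
      then show ?thesis
        by blast
    qed
  qed
  then have "\<forall>j\<in>{..<k}. \<exists>\<mu>. \<forall>v i. i < n \<longrightarrow> image v (u j) (\<beta> j) i = \<mu> * A v i"
    by simp
  from bchoice[OF this] obtain \<mu>
    where \<mu>: "\<And>j v i. j < k \<Longrightarrow> i < n \<Longrightarrow> image v (u j) (\<beta> j) i = \<mu> j * A v i"
    by auto
  have "\<forall>l\<in>{..<k}. \<exists>d. unit_col l = (\<lambda>j. 1 * u l j + d * u l0 j)"
    using basis by simp
  from bchoice[OF this] obtain d where d: "\<And>l. l < k \<Longrightarrow> unit_col l = (\<lambda>j. 1 * u l j + d l * u l0 j)"
    by (auto simp: lessThan_iff)
  \<comment> \<open>Since \<open>unit_col l\<close> is \<open>u l\<close> plus \<open>d l\<close>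
    times \<open>u l0\<close>, its images involve two multiples of the same \<open>A\<close>, and
    their row factors add up.\<close>
  define R where "R = (\<lambda>l b. s l b * \<mu> l + d l * s l0 b)"
  have Pl: "image v (unit_col l) b i = A v i * R l b" if "l < k" "b < k" "i < n" for v l b i
  proof -
    have "image v (unit_col l) b i = 1 * image v (u l) b i + d l * image v (u l0) b i"
      by (subst d[OF that(1)]) (rule image_linear_right[OF that(2,3)])
    also have "\<dots> = s l b * (\<mu> l * A v i) + d l * (s l0 b * A v i)"
      using factor[OF that, of v] factor[OF l0(1) that(2,3), of v] \<mu>[OF that(1,3)] by (simp add: A_def)
    finally show ?thesis
      by (simp add: R_def algebra_simps)
  qed
  have "T X b i = (\<Sum>l<k. (\<Sum>p<n. A (unit_col p) i * X l p) * R l b)" if "b < k" "i < n" for X b i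
  proof -
    have "A (X l) i = (\<Sum>p<n. A (unit_col p) i * X l p)" for l
      unfolding A_def using image_expand_left[OF \<beta>[OF l0(1)] that(2), of "X l"] by (simp add: mult.commute)
    then show ?thesis
      unfolding T_expand[OF that] using Pl that by simp
  qed
  then show ?thesis
    by (intro exI[of _ "\<lambda>i p. A (unit_col p) i"] exI[of _ R] allI impI)
qed

end

subsection \<open>Maps preserving the Cullis determinant of pencils\<close>

lemma cullis_det_mult_right:
  assumes X: "X \<in> carrier_mat n k" and B: "B \<in> carrier_mat k k"
  shows "cullis_det n k (X * B) = cullis_det n k X * det B"
proof -
  have "det (submatrix (X * B) I UNIV) = det (submatrix X I UNIV) * det B" if I: "I \<in> index_sets n k" for I
  proof -
    have "submatrix (X * B) I UNIV = submatrix X I UNIV * B"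
      unfolding submatrix_rows[OF I X] submatrix_rows[OF I mult_carrier_mat[OF X B]]
      using X B pick_less_index_set[OF I]
      by (intro eq_matI) (auto simp: scalar_prod_def)
    moreover have "submatrix X I UNIV \<in> carrier_mat k k"
      unfolding submatrix_rows[OF I X] by simp
    ultimately show ?thesis
      using det_mult[OF _ B] by simp
  qed
  then show ?thesis
    unfolding cullis_det_def by (simp add: sum_distrib_right mult.assoc)
qed

text \<open>Test matrices for the identity relating \<open>A\<close> and \<open>B\<close>: right
  multiplication by one selects the columns in \<open>I\<close>.\<close>

definition row_selection :: "nat \<Rightarrow> nat \<Rightarrow> nat set \<Rightarrow> 'a :: comm_ring_1 mat" where
  "row_selection n k I = mat n k (\<lambda>(p, l). if p = pick I l then 1 else 0)"

text \<open>A set \<open>J\<close> of the same size other than \<open>I\<close> misses some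
  \<open>p\<close> in \<open>I\<close>, so its minor has a zero column; the minor at
  \<open>I\<close> is the identity.\<close>

lemma cullis_det_row_selection:
  assumes I: "I \<in> index_sets n k"
  shows "cullis_det n k (row_selection n k I) = (cullis_sign k I :: 'a :: comm_ring_1)"
proof -
  let ?E = "row_selection n k I :: 'a mat"
  have E: "?E \<in> carrier_mat n k"
    by (simp add: row_selection_def)
  have pick_I: "pick I l \<in> I" "pick I l < n" if "l < k" for l
    using pick_in_set_le[of l I] pick_less_index_set[OF I that] that I
    unfolding index_sets_def by auto
  have pick_inj: "pick I l = pick I l' \<longleftrightarrow> l = l'" if "l < k" "l' < k" for l l'
    using pick_mono_le[of l' I l] pick_mono_le[of l I l'] that I
    unfolding index_sets_def by (cases l l' rule: linorder_cases) auto
  have entry: "submatrix ?E J UNIV $$ (i, l) = (if pick J i = pick I l then 1 else 0)"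
    if "J \<in> index_sets n k" "i < k" "l < k" for J i l
    using that pick_less_index_set[OF that(1)] unfolding submatrix_rows[OF that(1) E]
    by (simp add: row_selection_def)
  have M: "submatrix ?E J UNIV \<in> carrier_mat k k" if "J \<in> index_sets n k" for J
    unfolding submatrix_rows[OF that E] by simp
  have "submatrix ?E I UNIV = 1\<^sub>m k"
    using entry[OF I] M[OF I] by (intro eq_matI) (auto simp: pick_inj)
  then have self: "det (submatrix ?E I UNIV) = 1"
    by simp
  have other: "det (submatrix ?E J UNIV) = 0" if J: "J \<in> index_sets n k" "J \<noteq> I" for J
  proof -
    have fin: "finite I" "finite J" and c: "card I = k" "card J = k"
      using I J finite_subset[of _ "{0..<n}"] unfolding index_sets_def by auto
    have "\<not> I \<subseteq> J"
      using card_subset_eq[OF fin(2), of I] c J(2) by auto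
    then obtain p where p: "p \<in> I" "p \<notin> J"
      by blast
    define l where "l = card {a \<in> I. a < p}"
    have l: "pick I l = p" "l < k"
      using pick_card_in_set[OF p(1)] p(1) fin(1) c(1) unfolding l_def
      by (auto intro!: psubset_card_mono)
    have "pick J i \<noteq> p" if "i < k" for i
      using pick_in_set_le[of i J] that c(2) p(2) by auto
    then have "submatrix ?E J UNIV $$ (i, l) = 0" if "i < k" for i
      using entry[OF J(1) that l(2)] l(1) that by simp
    then show ?thesis
      by (subst laplace_expansion_column[OF M[OF J(1)] l(2)]) simp
  qed
  have "cullis_det n k ?E = (\<Sum>J\<in>{I}. cullis_sign k J * det (submatrix ?E J UNIV))"
    unfolding cullis_det_def using I other by (intro sum.mono_neutral_right) auto
  then show ?thesis
    using self by simp
qed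

lemma mult_row_selection:
  assumes A: "A \<in> carrier_mat n n" and I: "I \<in> index_sets n k"
  shows "A * row_selection n k I = submatrix A UNIV I"
proof -
  have c: "{j. j < n \<and> j \<in> I} = I" "card I = k"
    using I unfolding index_sets_def by auto
  then have "submatrix A UNIV I = mat n k (\<lambda>(i, l). A $$ (i, pick I l))"
    using A unfolding submatrix_def by (simp add: pick_UNIV)
  moreover have "A * row_selection n k I = mat n k (\<lambda>(i, l). A $$ (i, pick I l))"
  proof (rule eq_matI)
    fix i l assume "i < dim_row (mat n k (\<lambda>(i, l). A $$ (i, pick I l)))"
      and "l < dim_col (mat n k (\<lambda>(i, l). A $$ (i, pick I l)))"
    then have il: "i < n" "l < k"
      by simp_all
    have "(A * row_selection n k I) $$ (i, l) =
        (\<Sum>p\<in>{0..<n}. A $$ (i, p) * (if p = pick I l then 1 else 0))"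
      using A il by (simp add: row_selection_def scalar_prod_def)
    also have "\<dots> = (\<Sum>p\<in>{0..<n}. if p = pick I l then A $$ (i, p) else 0)"
      by (rule sum.cong) auto
    also have "\<dots> = A $$ (i, pick I l)"
      using pick_less_index_set[OF I il(2)] by simp
    finally show "(A * row_selection n k I) $$ (i, l) =
        mat n k (\<lambda>(i, l). A $$ (i, pick I l)) $$ (i, l)"
      using il by simp
  qed (use A in \<open>auto simp: row_selection_def\<close>)
  ultimately show ?thesis
    by simp
qed

lemma exists_third_scalar:
  assumes "infinite (UNIV :: 'a :: field set) \<or> card (UNIV :: 'a set) > 2"
  shows "\<exists>c :: 'a. c \<noteq> 0 \<and> c \<noteq> 1"
proof (rule ccontr)
  assume "\<not> ?thesis"
  then have U: "(UNIV :: 'a set) = {0, 1}"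
    by auto
  have "finite (UNIV :: 'a set)" "card (UNIV :: 'a set) = 2"
    unfolding U by simp_all
  with assms show False
    by simp
qed

theorem theorem6p15:
  fixes n k :: nat
    and \<phi> \<psi> :: "'a :: field mat \<Rightarrow> 'a mat"
  assumes "k \<ge> 3"
    and "n \<ge> k + 2"
    and "infinite (UNIV :: 'a set) \<or> card (UNIV :: 'a set) > k"
    and "even (n + k)"
    and "\<phi> \<in> carrier_mat n k \<rightarrow> carrier_mat n k"
    and "\<psi> \<in> carrier_mat n k \<rightarrow> carrier_mat n k"
    and "\<forall>X \<in> carrier_mat n k. \<forall>Y \<in> carrier_mat n k. \<forall>c :: 'a.
           cullis_det n k (X + c \<cdot>\<^sub>m Y) = cullis_det n k (\<phi> X + c \<cdot>\<^sub>m \<psi> Y)"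
  shows "\<exists>A \<in> carrier_mat n n. \<exists>B \<in> carrier_mat k k.
           (\<forall>I \<in> index_sets n k.
              cullis_det n k (submatrix A UNIV I) * det B = cullis_sign k I) \<and>
           (\<forall>X \<in> carrier_mat n k. \<phi> X = A * X * B \<and> \<psi> X = A * X * B)"
proof -
  \<comment> \<open>Deleting the last row and column \<open>q\<close> times leaves \<open>m\<close>
    rows and three columns; \<open>m\<close> is odd because \<open>n + k\<close> is even.\<close>
  define m q where "m = n - k + 3" and "q = k - 3"
  have size: "odd m" "3 \<le> m" "n = m + q" "k = 3 + q"
    using assms(1,2,4) unfolding m_def q_def by auto
  define mk :: "(nat \<Rightarrow> nat \<Rightarrow> 'a) \<Rightarrow> 'a mat" where "mk f = mat n k (\<lambda>(i, j). f j i)" for f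
  define \<Phi> where "\<Phi> f j i = \<phi> (mk f) $$ (i, j)" for f j i
  define \<Psi> where "\<Psi> f j i = \<psi> (mk f) $$ (i, j)" for f j i
  have mk [simp]: "mk f \<in> carrier_mat n k" for f
    by (simp add: mk_def)
  have mk_entry: "mk f $$ (i, j) = f j i" if "j < k" "i < n" for f i j
    using that by (simp add: mk_def)
  have mk_surj: "mk (\<lambda>j i. X $$ (i, j)) = X" if "X \<in> carrier_mat n k" for X
    using that by (auto simp: mk_def)
  have mk_cong: "mk f = mk g" if "\<And>j i. j < k \<Longrightarrow> i < n \<Longrightarrow> f j i = g j i" for f g
    using that by (auto simp: mk_def)
  have mk_\<Phi>: "mk (\<Phi> f) = \<phi> (mk f)" and mk_\<Psi>: "mk (\<Psi> f) = \<psi> (mk f)" for f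
    unfolding \<Phi>_def \<Psi>_def using assms(5,6) mk by (auto intro!: mk_surj)
  have mk_add: "mk (\<lambda>j i. f j i + c * g j i) = mk f + c \<cdot>\<^sub>m mk g" for f g c
    by (rule eq_matI) (auto simp: mk_def)
  have pres: "cullis_form n k (\<lambda>j i. X j i + c * Y j i) = cullis_form n k (\<lambda>j i. \<Phi> X j i + c * \<Psi> Y j i)" for X Y c
    using assms(7) mk unfolding cullis_form_def mk_def[symmetric] mk_add mk_\<Phi> mk_\<Psi> by blast
  have pres0: "cullis_form n k (\<Phi> X) = cullis_form n k X" for X
    using pres[of X 0 X] by simp
  have polar_eq: "polar n k r X Y = polar n k r (\<Phi> X) (\<Psi> Y)" if "r \<le> k" for r X Y
  proof (rule poly_sum_eq_coeffs[OF assms(3) _ that])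
    show "(\<Sum>r\<le>k. polar n k r X Y * c ^ r) = (\<Sum>r\<le>k. polar n k r (\<Phi> X) (\<Psi> Y) * c ^ r)" for c
      using pres[of X c Y] unfolding cullis_form_add_smult .
  qed
  have pair: "polar n k 1 (\<Phi> X) (\<Psi> Y) = polar n k 1 X Y" for X Y
    using polar_eq[of 1 X Y] assms(1) by simp
  \<comment> \<open>The polarisation of order \<open>k - 1\<close> is that of order 1 with swapped
    arguments, so the roles of the two maps can be exchanged.\<close>
  have pair': "polar n k 1 (\<Psi> X) (\<Phi> Y) = polar n k 1 X Y" for X Y
  proof -
    have c: "polar n k 1 U V = polar n k (k - 1) V U" for U V :: "nat \<Rightarrow> nat \<Rightarrow> 'a"
      by (rule polar_commute) (use assms(1) in simp)
    show ?thesis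
      unfolding c by (rule polar_eq[symmetric]) simp
  qed
  have \<Phi>_cong: "\<Phi> X = \<Phi> Y" if "\<And>j i. j < k \<Longrightarrow> i < n \<Longrightarrow> X j i = Y j i" for X Y
    unfolding \<Phi>_def using mk_cong[OF that] by simp
  have \<Phi>_linear: "\<Phi> (\<lambda>j i. a * X j i + b * Y j i) j i = a * \<Phi> X j i + b * \<Phi> Y j i"
    if "j < k" "i < n" for a b X Y j i
    by (rule polarised_pair_linear[OF size pair' that])
  have \<Phi>_surj: "\<exists>X. \<forall>j<k. \<forall>i<n. \<Phi> X j i = Z j i" for Z
    by (rule polarised_pair_surjective[OF size pair', of Z]) blast
  \<comment> \<open>Write \<open>\<Psi> Y\<close> as \<open>\<Phi> Y'\<close>. As
    \<open>\<Phi>\<close> is linear and preserves the form, \<open>X + c * Y\<close> and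
    \<open>X + c * Y'\<close> have equal values; separation for the pair of identity maps then gives
    \<open>Y = Y'\<close>.\<close>
  have \<Phi>_\<Psi>: "\<Psi> Y j i = \<Phi> Y j i" if "j < k" "i < n" for Y j i
  proof -
    obtain Y' where Y': "\<forall>j<k. \<forall>i<n. \<Phi> Y' j i = \<Psi> Y j i"
      using \<Phi>_surj[of "\<Psi> Y"] by (rule exE)
    have cullis_form_eq: "cullis_form n k (\<lambda>j i. X j i + c * Y j i) = cullis_form n k (\<lambda>j i. X j i + c * Y' j i)" for X c
    proof -
      have "cullis_form n k (\<lambda>j i. X j i + c * Y j i) = cullis_form n k (\<lambda>j i. \<Phi> X j i + c * \<Psi> Y j i)"
        by (rule pres)
      also have "\<dots> = cullis_form n k (\<Phi> (\<lambda>j i. 1 * X j i + c * Y' j i))"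
      proof (rule cullis_form_cong)
        fix i j assume "i < n" "j < k"
        then show "\<Phi> X j i + c * \<Psi> Y j i = \<Phi> (\<lambda>j i. 1 * X j i + c * Y' j i) j i"
          using Y' \<Phi>_linear[of j i 1 X c Y'] by (simp only: mult_1_left)
      qed
      also have "\<dots> = cullis_form n k (\<lambda>j i. X j i + c * Y' j i)"
        unfolding pres0 by simp
      finally show ?thesis .
    qed
    have "polar n k 1 X Y = polar n k 1 X Y'" for X
    proof (rule poly_sum_eq_coeffs[OF assms(3)])
      show "(\<Sum>r\<le>k. polar n k r X Y * c ^ r) = (\<Sum>r\<le>k. polar n k r X Y' * c ^ r)" for c
        using cullis_form_eq[of X c] unfolding cullis_form_add_smult .
    qed (use assms(1) in simp)
    then have "Y j i = Y' j i" if "j < k" "i < n" for j i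
      by (rule polarised_pair_separates[OF size, of "\<lambda>X. X" "\<lambda>X. X", OF refl _ that])
    then show ?thesis
      using \<Phi>_cong[of Y Y'] Y' that by simp
  qed
  interpret linear_cullis_preserver m q n k \<Phi>
  proof
    show "\<exists>c :: 'a. c \<noteq> 0 \<and> c \<noteq> 1"
      by (rule exists_third_scalar) (use assms(1,3) in auto)
    show "X j i = 0" if zero: "\<And>j i. j < k \<Longrightarrow> i < n \<Longrightarrow> \<Phi> X j i = 0" and "j < k" "i < n" for X j i
    proof (rule polar_1_nondegenerate[OF size _ that(2,3)])
      fix Z
      have "polar n k 1 Z X = polar n k 1 (\<Psi> Z) (\<Phi> X)"
        by (rule pair'[symmetric])
      also have "\<dots> = polar n k 1 (\<Psi> Z) (\<lambda>j i. 0 * X j i + 0 * X j i)"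
        by (rule polar_cong) (simp_all add: zero)
      also have "\<dots> = 0"
        unfolding polar_1_linear_combination by simp
      finally show "polar n k 1 Z X = 0" .
    qed
    show "polar n k 2 (\<Phi> X) (\<Phi> Y) = polar n k 2 X Y" for X Y
    proof -
      have "polar n k 2 (\<Phi> X) (\<Phi> Y) = polar n k 2 (\<Phi> X) (\<Psi> Y)"
        by (rule polar_cong) (simp_all add: \<Phi>_\<Psi>)
      then show ?thesis
        using polar_eq[of 2 X Y] assms(1) by simp
    qed
    show "k < n"
      using assms(2) by simp
    show "\<exists>X. \<forall>j<k. \<forall>i<n. \<Phi> X j i = Z j i" for Z
      by (rule \<Phi>_surj)
  qed (rule size \<Phi>_cong \<Phi>_linear; assumption?)+
  obtain A R where AR: "\<forall>X j i. j < k \<longrightarrow> i < n \<longrightarrow> \<Phi> X j i = (\<Sum>l<k. (\<Sum>p<n. A i p * X l p) * R l j)"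
    using two_sided_multiplication by (elim exE)
  define A' where "A' = mat n n (\<lambda>(i, p). A i p)"
  define B where "B = mat k k (\<lambda>(l, j). R l j)"
  have A': "A' \<in> carrier_mat n n" and B: "B \<in> carrier_mat k k"
    by (simp_all add: A'_def B_def)
  have \<phi>_eq: "\<phi> X = A' * X * B" if X: "X \<in> carrier_mat n k" for X
  proof (rule eq_matI)
    fix i j assume "i < dim_row (A' * X * B)" and "j < dim_col (A' * X * B)"
    then have ij: "i < n" "j < k"
      using A' B by auto
    have "\<phi> X $$ (i, j) = \<Phi> (\<lambda>j i. X $$ (i, j)) j i"
      unfolding \<Phi>_def mk_surj[OF X] ..
    also have "\<dots> = (\<Sum>l<k. (\<Sum>p<n. A i p * X $$ (p, l)) * R l j)"
      using AR ij by simp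
    also have "\<dots> = (A' * X * B) $$ (i, j)"
      using ij X by (simp add: A'_def B_def scalar_prod_def atLeast0LessThan)
    finally show "\<phi> X $$ (i, j) = (A' * X * B) $$ (i, j)" .
  qed (use assms(5) X A' B in auto)
  have \<psi>_eq: "\<psi> X = \<phi> X" if X: "X \<in> carrier_mat n k" for X
  proof -
    have "mk (\<Psi> (\<lambda>j i. X $$ (i, j))) = mk (\<Phi> (\<lambda>j i. X $$ (i, j)))"
      by (rule mk_cong) (rule \<Phi>_\<Psi>)
    then show ?thesis
      unfolding mk_\<Phi> mk_\<Psi> mk_surj[OF X] .
  qed
  \<comment> \<open>The preserved determinant is evaluated at the selection matrix of
    \<open>I\<close>, where it equals the sign.\<close>
  have "cullis_det n k (submatrix A' UNIV I) * det B = cullis_sign k I" if I: "I \<in> index_sets n k" for I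
  proof -
    let ?E = "row_selection n k I :: 'a mat"
    have E: "?E \<in> carrier_mat n k"
      by (simp add: row_selection_def)
    have "cullis_det n k (submatrix A' UNIV I) * det B = cullis_det n k (A' * ?E * B)"
      using cullis_det_mult_right[OF mult_carrier_mat[OF A' E] B] mult_row_selection[OF A' I] by simp
    also have "\<dots> = cullis_det n k ?E"
      using pres0[of "\<lambda>j i. ?E $$ (i, j)"]
      unfolding cullis_form_def mk_def[symmetric] mk_\<Phi> mk_surj[OF E] \<phi>_eq[OF E] .
    also have "\<dots> = cullis_sign k I"
      by (rule cullis_det_row_selection[OF I])
    finally show ?thesis .
  qed
  with A' B \<phi>_eq \<psi>_eq show ?thesis
    by (intro bexI[of _ A'] bexI[of _ B]) auto
qed

end
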